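(* Let $\nu\ge 1$ and let $a,b,c\in\{1,-1\}$. Let $B_{jk}\in\mathbb{C}$ ($j=1,2,3$, $k\in\bigwedge_{a,b,c}$) be such that $\sum_{k\in\bigwedge_{a,b,c}}B_{jk}\varphi_k\in IE(\mathbb{R}^3)$ for $j=1,2,3$ and $k_1B_{1k}+k_2B_{2k}+k_3B_{3k}=0$ for all $k\in\bigwedge_{a,b,c}$. Suppose that $$|B_{jk}|\le\frac{\exp\left(-\sum_{l=1}^3|k_l|\right)}{10^3}\prod_{l\in\{1,2,3\},\ |k_l|>0}\frac{|k_l|^{|k_l|-1}}{|k_l|!}\qquad\text{whenever }(ak_1,bk_2,ck_3)>(0,0,0),\ j=1,2,3 .$$ Then there exist functions $u_1,u_2,u_3,p:\mathbb{R}^3\times[0,+\infty)\to\mathbb{C}$ satisfying $$\begin{cases}\partial_t u_j+\sum_{m=1}^3\left(u_m\,\partial_{x_m}u_j-\nu\,\partial_{x_m}^2u_j\right)+\partial_{x_j}p=0, & j=1,2,3,\\ \partial_{x_1}u_1+\partial_{x_2}u_2+\partial_{x_3}u_3=0, & x\in\mathbb{R}^3,\ t\ge 0,\\ u_j(x,0)=\sum_{k\in\bigwedge_{a,b,c}}B_{jk}\varphi_k(x), & j=1,2,3.\end{cases}$$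
   Context: $\mathbb{N}=\{0,1,2,\dots\}$. For $k\in\mathbb{Z}^3$ and $x\in\mathbb{R}^3$, $\varphi_k(x)=\exp(ik_1x_1+ik_2x_2+ik_3x_3)$. For $a,b,c=\pm1$, $\bigwedge_{a,b,c}=\{(k_1,k_2,k_3)\mid(ak_1,bk_2,ck_3)\in\mathbb{N}^3\}$. The notation $(ak_1,bk_2,ck_3)>(0,0,0)$ means that $(ak_1,bk_2,ck_3)\in\mathbb{N}^3$ is not $(0,0,0)$ (some components may vanish). $IE(\mathbb{R}^3)$ is the linear space of all complex-valued $f\in C^\infty(\mathbb{R}^3)$ for which there are $h_k\in\mathbb{C}$ ($k\in\mathbb{Z}^3$) with $D^\beta f=\sum_{k\in\mathbb{Z}^3}h_kD^\beta\varphi_k$ for every multi-index $\beta\in\mathbb{N}^3$. *)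

theory Defs
  imports "HOL-Analysis.Analysis"
begin

definition phi :: "int^3 \<Rightarrow> real^3 \<Rightarrow> complex"
  where "phi k x = exp (\<i> * of_int (k$1) * of_real (x$1) + \<i> * of_int (k$2) * of_real (x$2)
                        + \<i> * of_int (k$3) * of_real (x$3))"

definition octant :: "int \<Rightarrow> int \<Rightarrow> int \<Rightarrow> (int^3) set"
  where "octant a b c = {k. a * k$1 \<in> \<nat> \<and> b * k$2 \<in> \<nat> \<and> c * k$3 \<in> \<nat>}"

definition pdifferentiable :: "3 \<Rightarrow> (real^3 \<Rightarrow> complex) \<Rightarrow> real^3 \<Rightarrow> bool"
  where "pdifferentiable m f x \<longleftrightarrow> (\<lambda>s::real. f (x + s *\<^sub>R axis m 1)) differentiable (at 0)"

text \<open>Meaningful only where \<^const>\<open>pdifferentiable\<close> holds; existence of the derivatives is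
  therefore required separately wherever \<open>pderiv_at\<close> is used below.\<close>

definition pderiv_at :: "3 \<Rightarrow> (real^3 \<Rightarrow> complex) \<Rightarrow> real^3 \<Rightarrow> complex"
  where "pderiv_at m f x = vector_derivative (\<lambda>s::real. f (x + s *\<^sub>R axis m 1)) (at 0)"

definition multi_deriv :: "nat^3 \<Rightarrow> (real^3 \<Rightarrow> complex) \<Rightarrow> real^3 \<Rightarrow> complex"
  where "multi_deriv \<beta> f =
    (pderiv_at 1 ^^ (\<beta>$1)) ((pderiv_at 2 ^^ (\<beta>$2)) ((pderiv_at 3 ^^ (\<beta>$3)) f))"

text \<open>The iterated partial derivatives, in any order, all exist and are continuous.\<close>

definition C_infinity :: "(real^3 \<Rightarrow> complex) \<Rightarrow> bool"
  where "C_infinity f \<longleftrightarrow> (\<forall>ms. continuous_on UNIV (foldr pderiv_at ms f) \<and>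
                              (\<forall>m x. pdifferentiable m (foldr pderiv_at ms f) x))"

text \<open>Sums over \<open>\<int>\<^sup>3\<close> carry no preferred ordering, so they are unordered sums, taken
  pointwise in \<open>x\<close>.\<close>

definition IE :: "(real^3 \<Rightarrow> complex) set"
  where "IE = {f. C_infinity f \<and>
    (\<exists>h. \<forall>\<beta> x. ((\<lambda>k. h k * multi_deriv \<beta> (phi k) x) has_sum multi_deriv \<beta> f x) UNIV)}"

text \<open>Classical solutions on \<open>\<real>\<^sup>3 \<times> [0,\<infinity>)\<close>: every derivative occurring in the equations exists
  at every point, the time derivative at \<open>t = 0\<close> being one-sided. Values at negative times are
  irrelevant. No periodicity or decay is imposed on the velocity or the pressure.\<close>

definition navier_stokes_solution ::
    "real \<Rightarrow> (3 \<Rightarrow> real^3 \<Rightarrow> real \<Rightarrow> complex) \<Rightarrow> (real^3 \<Rightarrow> real \<Rightarrow> complex) \<Rightarrow> bool"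
  where "navier_stokes_solution \<nu> u p \<longleftrightarrow>
    (\<forall>x. \<forall>t\<ge>0.
      (\<forall>j. u j x differentiable (at t within {0..})) \<and>
      (\<forall>j m. pdifferentiable m (\<lambda>y. u j y t) x) \<and>
      (\<forall>j m. pdifferentiable m (pderiv_at m (\<lambda>y. u j y t)) x) \<and>
      (\<forall>j. pdifferentiable j (\<lambda>y. p y t) x) \<and>
      (\<forall>j. vector_derivative (u j x) (at t within {0..})
            + (\<Sum>m\<in>UNIV. u m x t * pderiv_at m (\<lambda>y. u j y t) x
                 - of_real \<nu> * pderiv_at m (pderiv_at m (\<lambda>y. u j y t)) x)
            + pderiv_at j (\<lambda>y. p y t) x = 0) \<and>
      (\<Sum>m\<in>UNIV. pderiv_at m (\<lambda>y. u m y t) x) = 0)"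

end

theory Submission
  imports Defs
begin

text \<open>
  The solution is sought as a Fourier series whose frequencies stay in the given octant. For two
  nonzero frequencies of an octant the \<open>\<ell>\<^sup>1\<close> lengths add up, so a nonzero frequency is a sum
  of two nonzero frequencies in finitely many ways, all with strictly shorter summands. After elimination
  of the pressure, the equations for the coefficients therefore form a triangular system of linear
  ordinary differential equations with known right-hand sides, and they are solved for all times
  \<open>t \<ge> 0\<close> by recursion on the length of the frequency.

  Nothing bounds the coefficient \<open>B\<^sub>j\<^sub>0\<close> of the constant mode, and since it is complex,
  transport by it may amplify the mode \<open>k\<close> like \<open>exp (c |k| t)\<close>. But the pressure is not
  required to be periodic: a pressure that is linear in \<open>x\<close> lets the spatial mean be
  prescribed freely. It is taken to be \<open>B\<^sub>j\<^sub>0 exp (- K t)\<close>; for \<open>K\<close> large this costs only a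
  factor \<open>6/5\<close> in the heat semigroup, uniformly in the frequency (\<open>norm_symbol_quotient_le\<close>).

  By incompressibility the derivative in the nonlinear term can be moved to the output frequency,
  where the factor \<open>|k|\<close> that it produces is absorbed by the gain \<open>1 / (\<nu> |k|\<^sup>2)\<close> of the heat
  semigroup. So the coefficients are dominated, uniformly in time, by a family \<open>a\<close> of
  numbers (\<open>majorant\<close>) with \<open>a \<le> 6/5 b + 36/5 (a * a)\<close>, where \<open>b\<^sub>k\<close> is the maximum of
  \<open>|B\<^sub>j\<^sub>k|\<close> over \<open>j\<close> and \<open>*\<close> is the convolution (\<open>norm_amp_le\<close>).
  The hypothesis on the \<open>B\<^sub>j\<^sub>k\<close> is used only to see that \<open>b\<close> has small \<open>\<ell>\<^sup>1\<close> norm: the numbers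
  \<open>n\<^sup>n\<^sup>-\<^sup>1 e\<^sup>-\<^sup>n / n!\<close> have a small sum (\<open>sum_tree_weight_le\<close>), and smallness propagates to the
  majorant (\<open>sum_majorant_upto\<close>).

  For the equations to hold classically up to \<open>t = 0\<close>, two moments of the majorant must be finite
  (\<open>majorant_second_moment\<close>). They are inherited from the initial data, one power of \<open>|k|\<close> being
  gained at each step, and the initial data have two moments because they lie in \<open>IE\<close>: the
  coefficients occurring in the definition of \<open>IE\<close> must be the \<open>B\<^sub>j\<^sub>k\<close>, by uniqueness of
  absolutely convergent trigonometric expansions (\<open>fourier_unique\<close>).
\<close>

section \<open>Weights whose generating function is the tree function\<close>

text \<open>The summand \<open>n\<^sup>n\<^sup>-\<^sup>1 / n! x\<^sup>n\<close> of the tree function at \<open>x = 1/e\<close>. The value is 1 at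
  \<open>n = 0\<close>, so that a product over the coordinates ignores vanishing components.\<close>

definition tree_weight :: "nat \<Rightarrow> real"
  where "tree_weight n = exp (- real n) * (real n ^ (n - 1) / fact n)"

text \<open>The probability of the value \<open>n\<close> under the Poisson distribution with mean \<open>n\<close>. These numbers
  decrease, and their differences dominate the tree weights, so that the sum telescopes.\<close>

definition poisson_mode :: "nat \<Rightarrow> real"
  where "poisson_mode n = exp (- real n) * (real n ^ n / fact n)"

lemma tree_weight_nonneg: "tree_weight n \<ge> 0"
  by (simp add: tree_weight_def)

lemma exp_1_ge: "exp 1 \<ge> (8/3 :: real)"
proof -
  have "(\<Sum>n<4. 1 ^ n /\<^sub>R fact n) \<le> exp (1::real)"
    unfolding exp_def by (rule sum_le_suminf[OF summable_exp_generic]) auto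
  then show ?thesis by (simp add: eval_nat_numeral)
qed

lemma one_plus_inverse_power_le:
  assumes "n \<ge> 1"
  shows "(1 + 1 / real n) ^ n \<le> exp 1 * (1 - 1 / (4 * real n))"
proof (cases "n = 1")
  case True
  \<comment> \<open>The expansion of the logarithm used below is too weak for \<open>n = 1\<close>.\<close>
  then show ?thesis using exp_1_ge by simp
next
  case False
  define x where "x = 1 / real n"
  have n: "n \<ge> 2" using assms False by simp
  have x: "0 < x" "x \<le> 1/2" using n by (auto simp: x_def field_simps)
  have le: "ln (1 + x) \<le> x - x^2/2 + x^3/3"
  proof -
    have d: "((\<lambda>y. y - y^2/2 + y^3/3 - ln (1 + y)) has_real_derivative (1 - y + y^2 - 1/(1+y))) (at y)"
      if "y \<ge> 0" for y :: real
      using that by (auto intro!: derivative_eq_intros simp: power2_eq_square)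
    have nn: "1 - y + y^2 - 1/(1+y) \<ge> 0" if "y \<ge> 0" for y :: real
    proof -
      have "1 - y + y^2 - 1/(1+y) = y^3/(1+y)" using that
        by (simp add: field_simps power2_eq_square power3_eq_cube)
      then show ?thesis using that by simp
    qed
    have "(\<lambda>y. y - y^2/2 + y^3/3 - ln (1 + y)) 0 \<le> (\<lambda>y. y - y^2/2 + y^3/3 - ln (1 + y)) x"
      by (rule DERIV_nonneg_imp_nondecreasing) (use x d nn in \<open>auto intro!: exI\<close>)
    then show ?thesis by simp
  qed
  have "x^3 \<le> x^2 * (1/2)" using x by (simp add: power2_eq_square power3_eq_cube)
  with le have "ln (1 + x) \<le> x - x^2/3" by simp
  then have "real n * ln (1 + x) \<le> real n * (x - x^2/3)"
    by (intro mult_left_mono) auto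
  also have "\<dots> = 1 - x/3" using n by (simp add: x_def field_simps power2_eq_square)
  finally have a: "real n * ln (1 + x) \<le> 1 - x/3" .
  have "(1 + x) ^ n = exp (real n * ln (1 + x))"
    using x by (simp add: exp_of_nat_mult)
  also have "\<dots> \<le> exp (1 - x/3)" using a by simp
  also have "\<dots> = exp 1 / exp (x/3)" by (simp add: exp_diff)
  also have "\<dots> \<le> exp 1 / (1 + x/3)"
    using x by (intro divide_left_mono) (auto simp: exp_ge_add_one_self)
  also have "\<dots> \<le> exp 1 * (1 - x/4)"
  proof -
    have "1 \<le> (1 - x/4) * (1 + x/3)" using x by (simp add: field_simps)
    then have "1 / (1 + x/3) \<le> 1 - x/4" using x by (simp add: divide_le_eq)
    from mult_left_mono[OF this, of "exp 1"] show ?thesis by simp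
  qed
  finally show ?thesis by (simp add: x_def mult.commute)
qed

lemma tree_weight_le_difference:
  assumes "n \<ge> 1"
  shows "tree_weight n \<le> 4 * (poisson_mode n - poisson_mode (Suc n))"
proof -
  have p: "poisson_mode n \<ge> 0" by (simp add: poisson_mode_def)
  have t: "poisson_mode n = n * tree_weight n"
    using assms by (cases n) (auto simp: poisson_mode_def tree_weight_def)
  have exp_suc: "exp (- 1 - real n) = exp (- real n) / exp 1"
    by (simp add: exp_diff exp_minus field_simps)
  have frac: "real (Suc n) ^ Suc n / fact (Suc n) = real (Suc n) ^ n / fact n"
    by (simp del: of_nat_Suc)
  have "real (Suc n) ^ n = real n ^ n * (1 + 1 / real n) ^ n"
    using assms by (simp add: power_mult_distrib[symmetric] field_simps)
  then have "poisson_mode (Suc n) = poisson_mode n * ((1 + 1 / real n) ^ n / exp 1)"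
    using exp_suc frac by (simp add: poisson_mode_def mult_ac)
  also have "\<dots> \<le> poisson_mode n * (1 - 1 / (4 * real n))"
    using one_plus_inverse_power_le[OF assms] p
    by (intro mult_left_mono) (auto simp: divide_le_eq mult.commute)
  also have "\<dots> = poisson_mode n - tree_weight n / 4"
    using assms by (simp add: t field_simps)
  finally show ?thesis by simp
qed

lemma sum_tree_weight_le: "(\<Sum>n\<le>N. tree_weight n) \<le> 5/2"
proof -
  have *: "(\<Sum>n\<le>Suc N. tree_weight n) \<le> 1 + 4 * (exp (-1) - poisson_mode (Suc (Suc N)))" for N
  proof (induction N)
    case 0
    show ?case using tree_weight_le_difference[of 1]
      by (simp add: tree_weight_def[of 0] poisson_mode_def[of "Suc 0"] numeral_2_eq_2)
  next
    case (Suc N)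
    then show ?case using tree_weight_le_difference[of "Suc (Suc N)"] by simp
  qed
  have "exp (-1) \<le> (3/8::real)" using exp_1_ge by (simp add: exp_minus field_simps)
  moreover have "poisson_mode (Suc (Suc N)) \<ge> 0" by (simp add: poisson_mode_def)
  ultimately have "(\<Sum>n\<le>Suc N. tree_weight n) \<le> 5/2" using *[of N] by simp
  then show ?thesis using tree_weight_nonneg[of "Suc N"] by simp
qed


section \<open>Unordered series and calculus on a half-line\<close>

lemma has_sum_diff:
  fixes f g :: "'k \<Rightarrow> 'b::real_normed_vector"
  assumes "(f has_sum a) A" "(g has_sum b) A"
  shows "((\<lambda>k. f k - g k) has_sum (a - b)) A"
proof -
  have "((\<lambda>k. - g k) has_sum (- b)) A" using assms(2) by (simp add: has_sum_uminus)
  from has_sum_add[OF assms(1) this] show ?thesis by simp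
qed

lemma has_sum_finite_sum:
  fixes f :: "'i \<Rightarrow> 'k \<Rightarrow> 'b::topological_comm_monoid_add"
  assumes "finite I" "\<And>i. i \<in> I \<Longrightarrow> (f i has_sum a i) A"
  shows "((\<lambda>k. \<Sum>i\<in>I. f i k) has_sum (\<Sum>i\<in>I. a i)) A"
  using assms by (induction I rule: finite_induct) (auto intro!: has_sum_add)

text \<open>Termwise differentiation on a convex set, by dominated convergence of the difference quotients.\<close>

lemma has_vector_derivative_infsum:
  fixes f f' :: "'k \<Rightarrow> real \<Rightarrow> 'b::banach"
  assumes "convex S" "t \<in> S"
    and deriv: "\<And>k s. k \<in> A \<Longrightarrow> s \<in> S \<Longrightarrow> (f k has_vector_derivative f' k s) (at s within S)"
    and bound: "\<And>k s. k \<in> A \<Longrightarrow> s \<in> S \<Longrightarrow> norm (f' k s) \<le> M k"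
    and M: "M summable_on A"
    and summable: "\<And>s. s \<in> S \<Longrightarrow> (\<lambda>k. f k s) summable_on A"
  shows "((\<lambda>s. \<Sum>\<^sub>\<infinity>k\<in>A. f k s) has_vector_derivative (\<Sum>\<^sub>\<infinity>k\<in>A. f' k t)) (at t within S)"
proof -
  define q where
    "q k s = (1 / norm (s - t)) *\<^sub>R (f k s - (f k t + (s - t) *\<^sub>R f' k t))" for k s
  have f't: "(\<lambda>k. f' k t) summable_on A"
    by (rule abs_summable_summable, rule summable_on_comparison_test[OF M])
       (use bound \<open>t \<in> S\<close> in auto)
  have qle: "norm (q k s) \<le> 2 * M k" if "k \<in> A" "s \<in> S" for k s
  proof -
    have "norm (f k s - f k t) \<le> M k * norm (s - t)"
    proof (rule differentiable_bound[OF \<open>convex S\<close>])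
      show "(f k has_derivative (\<lambda>h. h *\<^sub>R f' k u)) (at u within S)" if "u \<in> S" for u
        using deriv[OF \<open>k \<in> A\<close> that] by (simp add: has_vector_derivative_def)
      show "onorm (\<lambda>h. h *\<^sub>R f' k u) \<le> M k" if "u \<in> S" for u
        using bound[OF \<open>k \<in> A\<close> that]
        by (intro onorm_le) (auto simp: mult.commute intro!: mult_left_mono)
    qed (use that \<open>t \<in> S\<close> in auto)
    moreover have "norm ((s - t) *\<^sub>R f' k t) \<le> M k * norm (s - t)"
      using bound[OF \<open>k \<in> A\<close> \<open>t \<in> S\<close>] 
      by (simp add: mult.commute[of "M k"] mult_left_mono)
    ultimately have "norm (f k s - f k t - (s - t) *\<^sub>R f' k t) \<le> 2 * M k * norm (s - t)"
      using norm_triangle_ineq4[of "f k s - f k t" "(s - t) *\<^sub>R f' k t"] by linarith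
    moreover have "0 \<le> M k" using bound[OF that] norm_ge_zero order_trans by blast
    ultimately show ?thesis
      by (cases "s = t") (auto simp: q_def divide_le_eq diff_diff_eq)
  qed
  have "uniform_limit S (\<lambda>X s. \<Sum>k\<in>X. q k s) (\<lambda>s. \<Sum>\<^sub>\<infinity>k\<in>A. q k s) (finite_subsets_at_top A)"
    by (rule Weierstrass_m_test_general[of _ _ _ "\<lambda>k. 2 * M k"])
       (use qle in \<open>auto intro: summable_on_cmult_right M\<close>)
  moreover have "\<forall>\<^sub>F X in finite_subsets_at_top A. ((\<lambda>s. \<Sum>k\<in>X. q k s) \<longlongrightarrow> 0) (at t within S)"
  proof (rule eventually_finite_subsets_at_top_weakI)
    fix X assume X: "finite X" "X \<subseteq> A"
    have "(q k \<longlongrightarrow> 0) (at t within S)" if "k \<in> X" for k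
      using deriv[of k t] that X \<open>t \<in> S\<close>
      unfolding has_vector_derivative_def has_derivative_within q_def
      by auto
    then have "((\<lambda>s. \<Sum>k\<in>X. q k s) \<longlongrightarrow> (\<Sum>k\<in>X. 0)) (at t within S)"
      by (intro tendsto_sum)
    then show "((\<lambda>s. \<Sum>k\<in>X. q k s) \<longlongrightarrow> 0) (at t within S)" by simp
  qed
  ultimately have lim: "((\<lambda>s. \<Sum>\<^sub>\<infinity>k\<in>A. q k s) \<longlongrightarrow> 0) (at t within S)"
    by (intro swap_uniform_limit[where g = "\<lambda>_. 0" and l = 0 and F = "finite_subsets_at_top A"]) auto
  have eq: "(\<Sum>\<^sub>\<infinity>k\<in>A. q k s) = (1 / norm (s - t)) *\<^sub>R
      ((\<Sum>\<^sub>\<infinity>k\<in>A. f k s) - ((\<Sum>\<^sub>\<infinity>k\<in>A. f k t) + (s - t) *\<^sub>R (\<Sum>\<^sub>\<infinity>k\<in>A. f' k t)))"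
    if "s \<in> S" for s
    unfolding q_def
    by (intro infsumI has_sum_scaleR has_sum_diff has_sum_add has_sum_infsum summable f't
          that \<open>t \<in> S\<close>)
  have "((\<lambda>s. (1 / norm (s - t)) *\<^sub>R
      ((\<Sum>\<^sub>\<infinity>k\<in>A. f k s) - ((\<Sum>\<^sub>\<infinity>k\<in>A. f k t) + (s - t) *\<^sub>R (\<Sum>\<^sub>\<infinity>k\<in>A. f' k t))))
     \<longlongrightarrow> 0) (at t within S)"
    by (rule tendsto_cong[THEN iffD1, OF _ lim]) (auto simp: eventually_at_filter eq)
  then show ?thesis
    unfolding has_vector_derivative_def has_derivative_within
    by (auto simp: bounded_linear_scaleR_left)
qed

lemma integral_has_vector_derivative_atLeast:
  fixes f :: "real \<Rightarrow> 'a::banach"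
  assumes "continuous_on {0..} f" "t \<ge> 0"
  shows "((\<lambda>u. integral {0..u} f) has_vector_derivative f t) (at t within {0..})"
proof -
  have "((\<lambda>u. integral {0..u} f) has_vector_derivative f t) (at t within {0..t + 1})"
    by (rule integral_has_vector_derivative)
       (use assms in \<open>auto intro: continuous_on_subset\<close>)
  moreover have "at t within {0..t + 1} = at t within {0..}"
    by (rule at_within_nhd[of t "{..<t + 1}"]) auto
  ultimately show ?thesis by simp
qed

lemma continuous_on_vector_derivative:
  assumes "\<And>t. t \<in> S \<Longrightarrow> (f has_vector_derivative f' t) (at t within S)"
  shows "continuous_on S f"
  using assms has_vector_derivative_continuous
  unfolding continuous_on_eq_continuous_within by blast

section \<open>Frequencies\<close>

text \<open>The \<open>\<ell>\<^sup>1\<close> length of a frequency, as a natural number because it is the measure of the recursions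
  below.\<close>

definition size1 :: "int^3 \<Rightarrow> nat"
  where "size1 k = (\<Sum>l\<in>UNIV. nat \<bar>k$l\<bar>)"

text \<open>The square of the Euclidean length, minus the symbol of the Laplacian.\<close>

definition sqnorm :: "int^3 \<Rightarrow> real"
  where "sqnorm k = (\<Sum>l\<in>UNIV. (real_of_int (k$l))\<^sup>2)"

lemma real_size1: "real (size1 k) = (\<Sum>l\<in>UNIV. \<bar>real_of_int (k$l)\<bar>)"
  by (simp add: size1_def)

lemma size1_eq_0_iff [simp]: "size1 k = 0 \<longleftrightarrow> k = 0"
  by (auto simp: size1_def vec_eq_iff)

lemma component_le_size1: "\<bar>real_of_int (k$l)\<bar> \<le> real (size1 k)"
  unfolding real_size1 by (rule member_le_sum) auto

lemma size1_le_sqnorm: "real (size1 k) \<le> sqnorm k"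
  unfolding real_size1 sqnorm_def
proof (rule sum_mono)
  fix l :: 3
  have "\<bar>z\<bar> \<le> z\<^sup>2" for z :: int
    using mult_left_mono[of 1 "\<bar>z\<bar>" "\<bar>z\<bar>"] by (cases "z = 0") (simp_all add: power2_eq_square)
  then have "\<bar>k$l\<bar> \<le> (k$l)\<^sup>2" .
  then have "real_of_int \<bar>k$l\<bar> \<le> real_of_int ((k$l)\<^sup>2)" by (simp only: of_int_le_iff)
  then show "\<bar>real_of_int (k$l)\<bar> \<le> (real_of_int (k$l))\<^sup>2" by simp
qed

lemma sqnorm_pos: "k \<noteq> 0 \<Longrightarrow> sqnorm k \<ge> 1"
proof -
  assume "k \<noteq> 0"
  then have "size1 k \<noteq> 0" by simp
  then have "1 \<le> real (size1 k)" by linarith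
  then show "sqnorm k \<ge> 1" using size1_le_sqnorm[of k] by linarith
qed

lemma size1_sq_le: "(real (size1 k))\<^sup>2 \<le> 3 * sqnorm k"
proof -
  have "(x + y + z)\<^sup>2 \<le> 3 * (x\<^sup>2 + y\<^sup>2 + z\<^sup>2)" for x y z :: real
  proof -
    have "0 \<le> (x-y)\<^sup>2 + (y-z)\<^sup>2 + (x-z)\<^sup>2" by simp
    then show ?thesis by (simp add: power2_eq_square algebra_simps)
  qed
  from this[of "\<bar>k$1\<bar>" "\<bar>k$2\<bar>" "\<bar>k$3\<bar>"] show ?thesis
    by (simp add: real_size1 sqnorm_def sum_3)
qed

text \<open>The factor 2 here is what makes the Leray projection cost a factor 3 in the maximum norm, see
  \<open>norm_force_le\<close>.\<close>

lemma component_size1_le: "\<bar>real_of_int (k$j)\<bar> * real (size1 k) \<le> 2 * sqnorm k"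
proof -
  have *: "\<bar>x\<bar> * (\<bar>x\<bar> + \<bar>y\<bar> + \<bar>z\<bar>) \<le> 2 * (x\<^sup>2 + y\<^sup>2 + z\<^sup>2)" for x y z :: real
  proof -
    have "0 \<le> (\<bar>x\<bar>-\<bar>y\<bar>)\<^sup>2 + (\<bar>x\<bar>-\<bar>z\<bar>)\<^sup>2 + (y\<^sup>2 + z\<^sup>2)" by simp
    also have "\<dots> = 2 * (x\<^sup>2 + y\<^sup>2 + z\<^sup>2) - 2 * (\<bar>x\<bar> * (\<bar>y\<bar> + \<bar>z\<bar>))"
      by (simp add: power2_eq_square algebra_simps)
    moreover have "\<bar>x\<bar> * (\<bar>x\<bar> + \<bar>y\<bar> + \<bar>z\<bar>) = x\<^sup>2 + \<bar>x\<bar> * (\<bar>y\<bar> + \<bar>z\<bar>)"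
      by (simp add: power2_eq_square algebra_simps)
    moreover have "0 \<le> (\<bar>x\<bar>-\<bar>y\<bar>)\<^sup>2 + (\<bar>x\<bar>-\<bar>z\<bar>)\<^sup>2" by simp
    then have "2 * (\<bar>x\<bar> * (\<bar>y\<bar> + \<bar>z\<bar>)) \<le> 2 * x\<^sup>2 + y\<^sup>2 + z\<^sup>2"
      by (simp add: power2_eq_square algebra_simps)
    moreover have "0 \<le> y\<^sup>2" "0 \<le> z\<^sup>2" by auto
    ultimately show ?thesis by (smt (verit))
  qed
  from exhaust_3[of j] show ?thesis
    using *[of "k$1" "k$2" "k$3"] *[of "k$2" "k$1" "k$3"] *[of "k$3" "k$1" "k$2"]
    by (auto simp: real_size1 sqnorm_def sum_3 algebra_simps)
qed

lemma finite_size1_le: "finite {k. size1 k \<le> n}"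
proof -
  let ?g = "\<lambda>(x,y,z). (vector [x,y,z] :: int^3)"
  let ?T = "{- int n..int n} \<times> {- int n..int n} \<times> {- int n..int n}"
  have "{k. size1 k \<le> n} \<subseteq> ?g ` ?T"
  proof
    fix k assume "k \<in> {k. size1 k \<le> n}"
    then have n: "real (size1 k) \<le> real n" by simp
    have "\<bar>k$l\<bar> \<le> int n" for l
    proof -
      have "real_of_int \<bar>k$l\<bar> \<le> real_of_int (int n)"
        using component_le_size1[of k l] n by simp
      then show ?thesis by (simp only: of_int_le_iff)
    qed
    from this[of 1] this[of 2] this[of 3] have "(k$1, k$2, k$3) \<in> ?T"
      unfolding mem_Sigma_iff atLeastAtMost_iff abs_le_iff by linarith
    moreover have "k = ?g (k$1, k$2, k$3)"
      unfolding prod.case vec_eq_iff forall_3 vector_3 by (intro conjI refl)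
    ultimately show "k \<in> ?g ` ?T" by (intro image_eqI[of k ?g "(k$1, k$2, k$3)"])
  qed
  moreover have "finite (?g ` ?T)"
    by (intro finite_imageI finite_cartesian_product finite_atLeastAtMost_int)
  ultimately show ?thesis by (rule finite_subset)
qed

text \<open>A set of nonzero frequencies closed under addition on which lengths add up. The nonzero
  frequencies of an octant are the example of interest.\<close>

locale mode_cone =
  fixes M :: "(int^3) set"
  assumes zero_notin: "0 \<notin> M"
    and add_closed: "q \<in> M \<Longrightarrow> r \<in> M \<Longrightarrow> q + r \<in> M"
    and size1_add: "q \<in> M \<Longrightarrow> r \<in> M \<Longrightarrow> size1 (q + r) = size1 q + size1 r"
begin

text \<open>The summands \<open>q\<close> in decompositions of \<open>k\<close> into two admissible frequencies.\<close>

definition splits :: "int^3 \<Rightarrow> (int^3) set"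
  where "splits k = {q \<in> M. k - q \<in> M}"

lemma size1_pos:
  assumes "k \<in> M"
  shows "size1 k \<ge> 1"
proof -
  have "k \<noteq> 0" using assms zero_notin by blast
  then have "size1 k \<noteq> 0" by simp
  then show ?thesis by linarith
qed

lemma splitsD:
  assumes "q \<in> splits k"
  shows "q \<in> M" "k - q \<in> M" "size1 k = size1 q + size1 (k - q)"
    "size1 q < size1 k" "size1 (k - q) < size1 k" "k \<in> M"
proof -
  show *: "q \<in> M" "k - q \<in> M" using assms by (simp_all add: splits_def)
  show **: "size1 k = size1 q + size1 (k - q)" using size1_add[OF *] by simp
  show "size1 q < size1 k" "size1 (k - q) < size1 k"
    using ** size1_pos[OF *(1)] size1_pos[OF *(2)] by linarith+
  show "k \<in> M" using add_closed[OF *] by simp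
qed

lemma finite_splits: "finite (splits k)"
proof (rule finite_subset[OF _ finite_size1_le[of "size1 k"]])
  show "splits k \<subseteq> {q. size1 q \<le> size1 k}" using splitsD(4) less_imp_le by blast
qed

text \<open>The Cauchy product of two absolutely convergent series over the frequencies.\<close>

lemma conv_has_sum:
  fixes f g :: "int^3 \<Rightarrow> 'a::{real_normed_field,banach,second_countable_topology}"
  assumes f: "(\<lambda>k. norm (f k)) summable_on M" and g: "(\<lambda>k. norm (g k)) summable_on M"
  shows "((\<lambda>k. \<Sum>q\<in>splits k. f q * g (k - q)) has_sum (\<Sum>\<^sub>\<infinity>k\<in>M. f k) * (\<Sum>\<^sub>\<infinity>k\<in>M. g k)) M"
proof -
  have "(\<lambda>p. norm (case p of (q, r) \<Rightarrow> f q * g r)) summable_on M \<times> M"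
  proof (rule Infinite_Sum.abs_summable_on_Sigma_iff[THEN iffD2], intro conjI ballI)
    show "(\<lambda>r. norm (case (q, r) of (q, r) \<Rightarrow> f q * g r)) summable_on M" for q
      unfolding prod.case norm_mult by (rule summable_on_cmult_right[OF g])
    have "(\<lambda>q. norm (norm (f q) * (\<Sum>\<^sub>\<infinity>r\<in>M. norm (g r)))) summable_on M"
      unfolding real_norm_def abs_mult abs_norm_cancel by (rule summable_on_cmult_left[OF f])
    then show "(\<lambda>q. norm (\<Sum>\<^sub>\<infinity>r\<in>M. norm (case (q, r) of (q, r) \<Rightarrow> f q * g r))) summable_on M"
      unfolding prod.case norm_mult infsum_cmult_right' .
  qed
  then have "(\<lambda>(q, r). f q * g r) summable_on M \<times> M" by (rule abs_summable_summable)
  then obtain S where S: "((\<lambda>(q, r). f q * g r) has_sum S) (M \<times> M)"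
    unfolding summable_on_def by blast
  have fs: "(f has_sum (\<Sum>\<^sub>\<infinity>k\<in>M. f k)) M" and gs: "(g has_sum (\<Sum>\<^sub>\<infinity>k\<in>M. g k)) M"
    by (rule has_sum_infsum[OF abs_summable_summable[OF f]]
             has_sum_infsum[OF abs_summable_summable[OF g]])+
  have "((\<lambda>q. f q * (\<Sum>\<^sub>\<infinity>k\<in>M. g k)) has_sum S) M"
  proof (rule has_sum_SigmaD[OF S])
    show "((\<lambda>r. case (q, r) of (q, r) \<Rightarrow> f q * g r) has_sum f q * (\<Sum>\<^sub>\<infinity>k\<in>M. g k)) M" for q
      unfolding prod.case by (rule has_sum_cmult_right[OF gs])
  qed
  moreover have "((\<lambda>q. f q * (\<Sum>\<^sub>\<infinity>k\<in>M. g k)) has_sum (\<Sum>\<^sub>\<infinity>k\<in>M. f k) * (\<Sum>\<^sub>\<infinity>k\<in>M. g k)) M"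
    by (rule has_sum_cmult_left[OF fs])
  ultimately have S_eq: "S = (\<Sum>\<^sub>\<infinity>k\<in>M. f k) * (\<Sum>\<^sub>\<infinity>k\<in>M. g k)" by (rule has_sum_unique)
  have reindex: "((\<lambda>(q, r). f q * g r) has_sum S) (M \<times> M)
      \<longleftrightarrow> ((\<lambda>(k, q). f q * g (k - q)) has_sum S) (Sigma M splits)"
    by (rule has_sum_reindex_bij_witness
          [where i = "\<lambda>(k, q). (q, k - q)" and j = "\<lambda>(q, r). (q + r, q)"])
       (auto simp: splits_def intro: add_closed)
  have s: "((\<lambda>(k, q). f q * g (k - q)) has_sum (\<Sum>\<^sub>\<infinity>k\<in>M. f k) * (\<Sum>\<^sub>\<infinity>k\<in>M. g k)) (Sigma M splits)"
    using reindex[THEN iffD1, OF S] unfolding S_eq .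
  show ?thesis
  proof (rule has_sum_SigmaD[OF s])
    show "((\<lambda>q. case (k, q) of (k, q) \<Rightarrow> f q * g (k - q)) has_sum
        (\<Sum>q\<in>splits k. f q * g (k - q))) (splits k)" for k
      unfolding prod.case by (rule has_sum_finite[OF finite_splits])
  qed
qed

end

section \<open>Absolutely convergent trigonometric series\<close>

text \<open>The inner product of a frequency and a point.\<close>

definition phase :: "int^3 \<Rightarrow> real^3 \<Rightarrow> real"
  where "phase k x = (\<Sum>l\<in>UNIV. real_of_int (k$l) * x$l)"

lemma phi_eq_cis: "phi k x = cis (phase k x)"
  by (simp add: phi_def phase_def cis_conv_exp sum_3 algebra_simps)

lemma norm_phi [simp]: "norm (phi k x) = 1"
  by (simp add: phi_eq_cis)

lemma phi_add_mode: "phi (k + q) x = phi k x * phi q x"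
  by (simp add: phi_eq_cis phase_def cis_mult sum.distrib distrib_right)

lemma phi_zero_mode [simp]: "phi 0 x = 1"
  by (simp add: phi_eq_cis phase_def)

lemma phi_add_axis: "phi k (x + s *\<^sub>R axis m 1) = phi k x * cis (real_of_int (k$m) * s)"
proof -
  have "phase k (x + s *\<^sub>R axis m 1) = phase k x + real_of_int (k$m) * s"
    unfolding phase_def
    by (simp add: axis_def distrib_left sum.distrib if_distrib[of "\<lambda>z. _ * z"] cong: if_cong)
  then show ?thesis by (simp add: phi_eq_cis cis_mult)
qed

lemma phi_axis_has_vector_derivative:
  "((\<lambda>s. c * phi k (x + s *\<^sub>R axis m 1)) has_vector_derivative
     \<i> * of_int (k$m) * c * phi k (x + s *\<^sub>R axis m 1)) (at s within S)"
proof -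
  have "((\<lambda>s. c * phi k x * cis (real_of_int (k$m) * s)) has_vector_derivative
     c * phi k x * ((\<i> * cis (real_of_int (k$m) * s)) * real_of_int (k$m))) (at s within S)"
    unfolding has_vector_derivative_def
    by (auto intro!: derivative_eq_intros simp: scaleR_conv_of_real algebra_simps)
  then show ?thesis by (simp add: phi_add_axis mult_ac)
qed

lemma pderiv_atI:
  assumes "((\<lambda>s. f (x + s *\<^sub>R axis m 1)) has_vector_derivative D) (at 0)"
  shows "pdifferentiable m f x" "pderiv_at m f x = D"
  using assms unfolding pdifferentiable_def pderiv_at_def
  by (auto intro: vector_derivative_at differentiableI_vector)

lemma pderiv_at_phi: "pderiv_at m (\<lambda>x. c * phi k x) = (\<lambda>x. \<i> * of_int (k$m) * c * phi k x)"
proof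
  fix x
  show "pderiv_at m (\<lambda>x. c * phi k x) x = \<i> * of_int (k$m) * c * phi k x"
    using pderiv_atI(2)[OF phi_axis_has_vector_derivative[of c k x m 0 UNIV]] by simp
qed

text \<open>The trigonometric series with coefficients \<open>c\<close> and frequencies in \<open>M\<close>.\<close>

definition fourier_sum :: "(int^3) set \<Rightarrow> (int^3 \<Rightarrow> complex) \<Rightarrow> real^3 \<Rightarrow> complex"
  where "fourier_sum M c x = (\<Sum>\<^sub>\<infinity>k\<in>M. c k * phi k x)"

lemma fourier_sum_has_sum:
  assumes "(\<lambda>k. norm (c k)) summable_on M"
  shows "((\<lambda>k. c k * phi k x) has_sum fourier_sum M c x) M"
    "(\<lambda>k. norm (c k * phi k x)) summable_on M"
proof -
  show *: "(\<lambda>k. norm (c k * phi k x)) summable_on M"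
    using assms by (simp add: norm_mult)
  show "((\<lambda>k. c k * phi k x) has_sum fourier_sum M c x) M"
    unfolding fourier_sum_def by (rule has_sum_infsum[OF abs_summable_summable[OF *]])
qed

lemma fourier_sum_has_pderiv:
  assumes c: "(\<lambda>k. norm (c k)) summable_on M" and c1: "(\<lambda>k. real (size1 k) * norm (c k)) summable_on M"
  shows "((\<lambda>s. fourier_sum M c (x + s *\<^sub>R axis m 1)) has_vector_derivative
           fourier_sum M (\<lambda>k. \<i> * of_int (k$m) * c k) x) (at 0)"
proof -
  have "((\<lambda>s. \<Sum>\<^sub>\<infinity>k\<in>M. c k * phi k (x + s *\<^sub>R axis m 1)) has_vector_derivative
     (\<Sum>\<^sub>\<infinity>k\<in>M. \<i> * of_int (k$m) * c k * phi k (x + 0 *\<^sub>R axis m 1))) (at 0 within UNIV)"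
  proof (rule has_vector_derivative_infsum[where M = "\<lambda>k. real (size1 k) * norm (c k)"])
    show "((\<lambda>s. c k * phi k (x + s *\<^sub>R axis m 1)) has_vector_derivative
       \<i> * of_int (k$m) * c k * phi k (x + s *\<^sub>R axis m 1)) (at s within UNIV)" for k s
      by (rule phi_axis_has_vector_derivative)
    show "norm (\<i> * of_int (k$m) * c k * phi k (x + s *\<^sub>R axis m 1)) \<le> real (size1 k) * norm (c k)"
      for k s
      using component_le_size1[of k m] by (simp add: norm_mult mult_right_mono)
    show "(\<lambda>k. c k * phi k (x + s *\<^sub>R axis m 1)) summable_on M" for s
      using fourier_sum_has_sum(2)[OF c] by (rule abs_summable_summable)
  qed (use c1 in auto)
  then show ?thesis by (simp add: fourier_sum_def)
qed

lemma sum_cis_roots: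
  assumes "N > 0"
  shows "(\<Sum>n<N. cis (real_of_int z * (2 * pi * real n / real N))) = (if int N dvd z then of_nat N else 0)"
proof -
  define w where "w = cis (real_of_int z * (2 * pi / real N))"
  have pw: "w ^ n = cis (real_of_int z * (2 * pi * real n / real N))" for n
    unfolding w_def Complex.DeMoivre by (simp add: mult_ac)
  have wN: "w ^ N = 1"
    using assms cis_multiple_2pi[of "real_of_int z"] by (simp add: pw mult_ac)
  have w1: "w = 1 \<longleftrightarrow> int N dvd z"
  proof
    assume "w = 1"
    then have "cos (real_of_int z * (2 * pi / real N)) = 1"
      by (simp add: w_def complex_eq_iff)
    then obtain r :: int where "real_of_int z * (2 * pi / real N) = of_int r * 2 * pi"
      using cos_one_2pi_int by blast
    then have "real_of_int z = real_of_int (r * int N)" using assms by (simp add: field_simps)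
    then have "z = r * int N" by (simp only: of_int_eq_iff)
    then show "int N dvd z" by simp
  next
    assume "int N dvd z"
    then obtain r where "z = int N * r" by blast
    then have "real_of_int z * (2 * pi / real N) = 2 * pi * real_of_int r"
      using assms by (simp add: field_simps)
    then show "w = 1" unfolding w_def by (simp only: cis_multiple_2pi Ints_of_int)
  qed
  have "(\<Sum>n<N. w ^ n) = (if int N dvd z then of_nat N else 0)"
    using wN w1 by (auto simp: geometric_sum)
  then show ?thesis by (simp add: pw)
qed

text \<open>If a trigonometric series vanishes identically, then so does the subseries of all frequencies
  whose \<open>l\<close>-th component is congruent to that of \<open>m\<close>: average over \<open>N\<close> equidistant translates in
  the direction \<open>l\<close>, weighted by a character.\<close>

lemma has_sum_sieve:
  assumes "\<And>x. ((\<lambda>k. c k * phi k x) has_sum 0) UNIV" and "N > 0"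
  shows "((\<lambda>k. (if int N dvd (k$l - m$l) then c k else 0) * phi k x) has_sum 0) UNIV"
proof -
  define y where "y n = x + (2 * pi * real n / real N) *\<^sub>R axis l 1" for n
  define r where "r n = cis (- (real_of_int (m$l) * (2 * pi * real n / real N))) / of_nat N" for n
  have "((\<lambda>k. \<Sum>n<N. r n * (c k * phi k (y n))) has_sum (\<Sum>n<N. r n * 0)) UNIV"
    by (intro has_sum_finite_sum finite_lessThan has_sum_cmult_right assms)
  moreover have "(\<Sum>n<N. r n * (c k * phi k (y n)))
      = (if int N dvd (k$l - m$l) then c k else 0) * phi k x" for k
  proof -
    have "r n * (c k * phi k (y n))
        = c k * phi k x / of_nat N * cis (real_of_int (k$l - m$l) * (2 * pi * real n / real N))" for n
    proof -
      have "cis (real_of_int (k$l - m$l) * (2 * pi * real n / real N))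
        = cis (- (real_of_int (m$l) * (2 * pi * real n / real N)))
          * cis (real_of_int (k$l) * (2 * pi * real n / real N))"
        by (simp add: cis_mult left_diff_distrib diff_divide_distrib)
      then show ?thesis by (simp add: r_def y_def phi_add_axis)
    qed
    then have "(\<Sum>n<N. r n * (c k * phi k (y n)))
      = c k * phi k x / of_nat N * (if int N dvd (k$l - m$l) then of_nat N else 0)"
      by (simp only: sum_distrib_left[symmetric] sum_cis_roots[OF \<open>N > 0\<close>])
    then show ?thesis using \<open>N > 0\<close> by simp
  qed
  ultimately show ?thesis by simp
qed

text \<open>Sieving modulo a large \<open>N\<close> isolates the coefficient of the mode \<open>m\<close> up to a small tail of the series.\<close>

lemma fourier_unique:
  assumes c: "(\<lambda>k. norm (c k)) summable_on UNIV" and z: "\<And>x. ((\<lambda>k. c k * phi k x) has_sum 0) UNIV"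
  shows "c m = 0"
proof -
  have "norm (c m) \<le> \<epsilon>" if "\<epsilon> > 0" for \<epsilon>
  proof -
    have T: "((\<lambda>k. norm (c k)) has_sum (\<Sum>\<^sub>\<infinity>k. norm (c k))) UNIV"
      using c by (rule has_sum_infsum)
    then obtain F where F: "finite F" "dist (\<Sum>k\<in>F. norm (c k)) (\<Sum>\<^sub>\<infinity>k. norm (c k)) \<le> \<epsilon>"
      using has_sum_finite_approximation[OF _ \<open>\<epsilon> > 0\<close>] by blast
    \<comment> \<open>With this modulus no frequency of \<open>F\<close> except \<open>m\<close> is congruent to \<open>m\<close> in all components.\<close>
    define N where "N = Suc (Max (insert 0 ((\<lambda>k. size1 (k - m)) ` F)))"
    have N: "size1 (k - m) < N" if "k \<in> F" for k
      unfolding N_def less_Suc_eq_le by (rule Max_ge) (use F that in auto)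
    have N0: "N > 0" by (simp add: N_def)
    define d where "d k = (if \<forall>l. int N dvd (k$l - m$l) then c k else 0)" for k
    \<comment> \<open>Sieving once in each direction leaves the frequencies congruent to \<open>m\<close> modulo \<open>N\<close>.\<close>
    have "((\<lambda>k. (if int N dvd (k$1 - m$1) then if int N dvd (k$2 - m$2) then
        if int N dvd (k$3 - m$3) then c k else 0 else 0 else 0) * phi k 0) has_sum 0) UNIV"
      by (intro has_sum_sieve z N0)
    also have "(\<lambda>k. (if int N dvd (k$1 - m$1) then if int N dvd (k$2 - m$2) then
        if int N dvd (k$3 - m$3) then c k else 0 else 0 else 0) * phi k 0) = d"
      by (auto simp: d_def forall_3 phi_eq_cis phase_def)
    finally have d: "(d has_sum 0) UNIV" .
    have dF: "d k = 0" if "k \<in> F" "k \<noteq> m" for k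
    proof -
      have "\<exists>l. k$l - m$l \<noteq> 0" using that by (auto simp: vec_eq_iff)
      then obtain l where l: "k$l - m$l \<noteq> 0" by blast
      have "\<bar>real_of_int ((k - m)$l)\<bar> < real N"
        using component_le_size1[of "k - m" l] N[OF that(1)] by linarith
      then have "\<bar>k$l - m$l\<bar> < int N" by simp
      then have "\<not> int N dvd (k$l - m$l)" using l dvd_imp_le_int[of "k$l - m$l" "int N"] by auto
      then show ?thesis by (auto simp: d_def)
    qed
    let ?G = "insert m F"
    have "sum d ?G = d m + sum d (F - {m})" using F by (simp add: sum.insert_remove)
    also have "sum d (F - {m}) = 0" by (rule sum.neutral) (use dF in auto)
    finally have "(d has_sum (0 - d m)) (UNIV - ?G)"
      using F by (intro has_sum_Diff d) (auto intro!: has_sum_finiteI)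
    moreover have "((\<lambda>k. norm (c k)) has_sum ((\<Sum>\<^sub>\<infinity>k. norm (c k)) - (\<Sum>k\<in>?G. norm (c k)))) (UNIV - ?G)"
      using F T by (intro has_sum_Diff) (auto intro!: has_sum_finiteI)
    ultimately have "norm (0 - d m) \<le> (\<Sum>\<^sub>\<infinity>k. norm (c k)) - (\<Sum>k\<in>?G. norm (c k))"
      by (rule norm_infsum_le) (simp add: d_def)
    also have "\<dots> \<le> (\<Sum>\<^sub>\<infinity>k. norm (c k)) - (\<Sum>k\<in>F. norm (c k))"
      using F by (intro diff_left_mono sum_mono2) auto
    also have "\<dots> \<le> \<epsilon>" using F(2) by (simp add: dist_real_def)
    finally show ?thesis by (simp add: d_def)
  qed
  then show ?thesis using field_le_epsilon[of "norm (c m)" 0] by simp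
qed

section \<open>Second moments of the coefficients of a function in \<open>IE\<close>\<close>

lemma multi_deriv_phi_second:
  "multi_deriv (\<chi> i. if i = l then 2 else 0) (phi k) x = - (of_int (k$l))\<^sup>2 * phi k x"
proof -
  have ii: "\<i> * x * (\<i> * x) * z = - (x * x * z)" for x z :: complex
  proof -
    have "\<i> * x * (\<i> * x) * z = (\<i> * \<i>) * (x * x * z)" by (simp only: mult_ac)
    then show ?thesis by simp
  qed
  have 1: "pderiv_at l (phi k) = (\<lambda>x. \<i> * of_int (k$l) * phi k x)"
    using pderiv_at_phi[of l 1 k] by simp
  have 2: "pderiv_at l (pderiv_at l (phi k)) = (\<lambda>x. - (of_int (k$l))\<^sup>2 * phi k x)"
    unfolding 1 pderiv_at_phi
    by (simp add: ii power2_eq_square)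
  from exhaust_3[of l] show ?thesis
    using 2 by (auto simp: multi_deriv_def eval_nat_numeral)
qed

lemma multi_deriv_zero: "multi_deriv 0 f = f"
  by (simp add: multi_deriv_def)

text \<open>The coefficients \<open>h\<close> provided by the definition of \<open>IE\<close> coincide with \<open>c\<close>; hence the series of the
  pure second derivatives, evaluated at the origin, converge absolutely.\<close>

lemma IE_second_moment:
  assumes sum: "\<And>x. (\<lambda>k. c k * phi k x) summable_on S"
    and IE: "(\<lambda>x. \<Sum>\<^sub>\<infinity>k\<in>S. c k * phi k x) \<in> IE"
  shows "(\<lambda>k. sqnorm k * norm (c k)) summable_on S"
proof -
  let ?f = "\<lambda>x. \<Sum>\<^sub>\<infinity>k\<in>S. c k * phi k x"
  define C where "C k = (if k \<in> S then c k else 0)" for k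
  from IE obtain h where
    h: "\<And>\<beta> x. ((\<lambda>k. h k * multi_deriv \<beta> (phi k) x) has_sum multi_deriv \<beta> ?f x) UNIV"
    unfolding IE_def by blast
  have hs: "((\<lambda>k. h k * phi k x) has_sum ?f x) UNIV" for x
    using h[of 0 x] unfolding multi_deriv_zero .
  have cs: "((\<lambda>k. C k * phi k x) has_sum ?f x) UNIV" for x
  proof -
    have "((\<lambda>k. c k * phi k x) has_sum ?f x) S" using sum by (rule has_sum_infsum)
    then show ?thesis
      by (rule has_sum_cong_neutral[THEN iffD1, rotated -1]) (auto simp: C_def)
  qed
  have norm_hs: "(\<lambda>k. norm (h k)) summable_on UNIV"
    using has_sum_imp_summable[OF hs[of 0]]
    unfolding summable_on_iff_abs_summable_on_complex by (simp add: norm_mult)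
  have norm_cs: "(\<lambda>k. norm (C k)) summable_on UNIV"
    using has_sum_imp_summable[OF cs[of 0]]
    unfolding summable_on_iff_abs_summable_on_complex by (simp add: norm_mult)
  have "(\<lambda>k. norm (C k - h k)) summable_on UNIV"
  proof (rule summable_on_comparison_test)
    show "(\<lambda>k. norm (C k) + norm (h k)) summable_on UNIV"
      by (rule summable_on_add[OF norm_cs norm_hs])
  qed (auto simp: norm_triangle_ineq4)
  moreover have "((\<lambda>k. (C k - h k) * phi k x) has_sum 0) UNIV" for x
    using has_sum_diff[OF cs[of x] hs[of x]] by (simp add: left_diff_distrib)
  ultimately have "C k - h k = 0" for k by (rule fourier_unique)
  then have hC: "h = C" by (simp add: fun_eq_iff)
  have "(\<lambda>k. (real_of_int (k$l))\<^sup>2 * norm (C k)) summable_on UNIV" for l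
    using has_sum_imp_summable[OF h[of "\<chi> i. if i = l then 2 else 0" 0]]
    unfolding summable_on_iff_abs_summable_on_complex multi_deriv_phi_second hC
    by (simp add: norm_mult norm_power mult.commute)
  then have "(\<lambda>k. \<Sum>l\<in>UNIV. (real_of_int (k$l))\<^sup>2 * norm (C k)) summable_on UNIV"
    unfolding sum_3 by (intro summable_on_add)
  then have "(\<lambda>k. sqnorm k * norm (C k)) summable_on UNIV"
    by (simp add: sqnorm_def sum_distrib_right)
  then have "(\<lambda>k. sqnorm k * norm (C k)) summable_on S"
    by (rule summable_on_subset_banach) auto
  then show ?thesis
    by (rule summable_on_cong[THEN iffD1, rotated]) (auto simp: C_def)
qed

section \<open>Octants\<close>

lemma octant_iff: "k \<in> octant a b c \<longleftrightarrow> a * k$1 \<ge> 0 \<and> b * k$2 \<ge> 0 \<and> c * k$3 \<ge> 0"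
  by (simp add: octant_def Nats_altdef1)

lemma mode_cone_octant:
  assumes "a \<in> {1, -1}" "b \<in> {1, -1}" "c \<in> {1, -1}"
  shows "mode_cone (octant a b c - {0})"
proof -
  have abs_add: "\<bar>x + y\<bar> = \<bar>x\<bar> + \<bar>y\<bar>" if "e * x \<ge> 0" "e * y \<ge> 0" "e \<in> {1, -1}" for e x y :: int
    using that by auto
  have add: "size1 (q + r) = size1 q + size1 r" if "q \<in> octant a b c" "r \<in> octant a b c" for q r
  proof -
    have "\<bar>(q + r)$l\<bar> = \<bar>q$l\<bar> + \<bar>r$l\<bar>" for l
      using that assms exhaust_3[of l] unfolding octant_iff by (auto intro!: abs_add)
    then show ?thesis by (simp add: size1_def nat_add_distrib sum.distrib)
  qed
  have closed: "q + r \<in> octant a b c" if "q \<in> octant a b c" "r \<in> octant a b c" for q r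
    using that unfolding octant_iff by (simp add: distrib_left)
  show ?thesis
  proof
    fix q r assume q: "q \<in> octant a b c - {0}" and r: "r \<in> octant a b c - {0}"
    show "size1 (q + r) = size1 q + size1 r" using add q r by simp
    then have "size1 (q + r) \<noteq> 0" using q by simp
    then have "q + r \<noteq> 0" by (simp only: size1_eq_0_iff not_False_eq_True)
    then show "q + r \<in> octant a b c - {0}" using closed q r by simp
  qed simp
qed

lemma prod_3: "prod f (UNIV :: 3 set) = f 1 * f 2 * (f 3 :: 'a :: comm_monoid_mult)"
  unfolding UNIV_3 by (simp add: mult.assoc)

text \<open>Taking absolute values embeds an octant into \<open>\<nat>\<^sup>3\<close>, where the sum factorizes into three copies of
  the one-dimensional sum: \<open>(5/2)\<^sup>3 \<le> 16\<close>.\<close>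

lemma sum_tree_weights_octant:
  assumes "a \<in> {1, -1}" "b \<in> {1, -1}" "c \<in> {1, -1}" and F: "finite F" "F \<subseteq> octant a b c"
  shows "(\<Sum>k\<in>F. \<Prod>l\<in>UNIV. tree_weight (nat \<bar>k$l\<bar>)) \<le> 16"
proof -
  let ?g = "\<lambda>k::int^3. (nat \<bar>k$1\<bar>, nat \<bar>k$2\<bar>, nat \<bar>k$3\<bar>)"
  let ?w = "\<lambda>(x, y, z). tree_weight x * tree_weight y * tree_weight z"
  have abs_eq: "x = y" if "e * x \<ge> 0" "e * y \<ge> 0" "e \<in> {1, -1}" "nat \<bar>x\<bar> = nat \<bar>y\<bar>" for e x y :: int
    using that by auto
  have inj: "inj_on ?g F"
  proof (rule inj_onI)
    fix k q assume kq: "k \<in> F" "q \<in> F" and eq: "?g k = ?g q"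
    have k: "a * k$1 \<ge> 0 \<and> b * k$2 \<ge> 0 \<and> c * k$3 \<ge> 0"
      and q: "a * q$1 \<ge> 0 \<and> b * q$2 \<ge> 0 \<and> c * q$3 \<ge> 0"
      using kq F octant_iff by blast+
    have n: "nat \<bar>k$1\<bar> = nat \<bar>q$1\<bar>" "nat \<bar>k$2\<bar> = nat \<bar>q$2\<bar>" "nat \<bar>k$3\<bar> = nat \<bar>q$3\<bar>"
      using eq by blast+
    have "k$1 = q$1" "k$2 = q$2" "k$3 = q$3"
      using abs_eq[OF _ _ assms(1) n(1)] abs_eq[OF _ _ assms(2) n(2)] abs_eq[OF _ _ assms(3) n(3)]
        k q by blast+
    then show "k = q" unfolding vec_eq_iff forall_3 by blast
  qed
  define N where "N = Max (insert 0 (size1 ` F))"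
  have N: "nat \<bar>k$l\<bar> \<le> N" if "k \<in> F" for k l
  proof -
    have "size1 k \<le> N" unfolding N_def using F(1) that by (intro Max_ge) auto
    moreover have "nat \<bar>k$l\<bar> \<le> size1 k" unfolding size1_def by (rule member_le_sum) simp_all
    ultimately show ?thesis by (rule order_trans[rotated])
  qed
  have "(\<Sum>k\<in>F. \<Prod>l\<in>UNIV. tree_weight (nat \<bar>k$l\<bar>)) = (\<Sum>k\<in>F. ?w (?g k))"
    by (simp only: prod_3 prod.case)
  also have "\<dots> = sum ?w (?g ` F)" by (simp add: sum.reindex[OF inj])
  also have "\<dots> \<le> sum ?w ({..N} \<times> {..N} \<times> {..N})"
  proof (rule sum_mono2)
    show "?g ` F \<subseteq> {..N} \<times> {..N} \<times> {..N}"
    proof (rule image_subsetI)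
      show "?g k \<in> {..N} \<times> {..N} \<times> {..N}" if "k \<in> F" for k
        unfolding mem_Sigma_iff atMost_iff using N[OF that] by blast
    qed
    show "?w x \<ge> 0" for x by (cases x) (simp add: tree_weight_nonneg)
  qed simp
  also have "\<dots> = (\<Sum>x\<le>N. \<Sum>y\<le>N. \<Sum>z\<le>N. tree_weight x * tree_weight y * tree_weight z)"
    by (simp only: sum.cartesian_product)
  also have "\<dots> = (\<Sum>n\<le>N. tree_weight n) ^ 3"
    by (simp only: sum_distrib_left[symmetric] sum_distrib_right[symmetric] power3_eq_cube)
  also have "\<dots> \<le> (5/2) ^ 3"
    by (intro power_mono sum_tree_weight_le sum_nonneg tree_weight_nonneg)
  finally show ?thesis by (simp add: power3_eq_cube)
qed

lemma tree_weight_prod_eq: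
  "exp (- (\<Sum>l\<in>UNIV. real_of_int \<bar>k$l\<bar>)) *
     (\<Prod>l\<in>{l. \<bar>k$l\<bar> > 0}. real_of_int \<bar>k$l\<bar> ^ (nat \<bar>k$l\<bar> - 1) / fact (nat \<bar>k$l\<bar>))
   = (\<Prod>l\<in>UNIV. tree_weight (nat \<bar>k$l\<bar>))" for k :: "int^3"
proof -
  have "(\<Prod>l\<in>{l. \<bar>k$l\<bar> > 0}. real_of_int \<bar>k$l\<bar> ^ (nat \<bar>k$l\<bar> - 1) / fact (nat \<bar>k$l\<bar>))
    = (\<Prod>l\<in>UNIV. real (nat \<bar>k$l\<bar>) ^ (nat \<bar>k$l\<bar> - 1) / fact (nat \<bar>k$l\<bar>))"
    by (rule prod.mono_neutral_cong_left) auto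
  moreover have "exp (- (\<Sum>l\<in>UNIV. real_of_int \<bar>k$l\<bar>)) = (\<Prod>l\<in>UNIV. exp (- real (nat \<bar>k$l\<bar>)))"
    by (simp add: exp_sum[symmetric] sum_negf)
  ultimately show ?thesis by (simp add: prod.distrib[symmetric] tree_weight_def)
qed

section \<open>The projected quadratic term\<close>

text \<open>The bilinear (not sesquilinear) product of a frequency with a complex vector; \<open>\<i>\<close> times it is
  the Fourier symbol of the divergence.\<close>

definition dot :: "int^3 \<Rightarrow> (3 \<Rightarrow> complex) \<Rightarrow> complex"
  where "dot k v = (\<Sum>l\<in>UNIV. of_int (k$l) * v l)"

lemma norm_dot_le:
  assumes "\<And>l. norm (v l) \<le> R"
  shows "norm (dot k v) \<le> real (size1 k) * R"
proof -
  have "norm (dot k v) \<le> (\<Sum>l\<in>UNIV. \<bar>real_of_int (k$l)\<bar> * R)"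
    unfolding dot_def
    by (rule order_trans[OF norm_sum], rule sum_mono)
       (use assms in \<open>auto simp: norm_mult intro: mult_left_mono\<close>)
  then show ?thesis by (simp add: real_size1 sum_distrib_right)
qed

lemma dot_self: "dot k (\<lambda>l. of_int (k$l) * z) = of_real (sqnorm k) * z"
  by (simp add: dot_def sqnorm_def sum_distrib_right power2_eq_square mult.assoc)

context mode_cone
begin

text \<open>The \<open>k\<close>-th Fourier coefficient of the convective term \<open>(V \<cdot> \<nabla>) V\<close> for a divergence-free field
  with coefficients \<open>V\<close>. The derivative has been moved to the output frequency: since \<open>q \<cdot> V\<^sub>q = 0\<close>,
  the factors \<open>(k - q) \<cdot> V\<^sub>q\<close> and \<open>k \<cdot> V\<^sub>q\<close> agree.\<close>

definition quad :: "int^3 \<Rightarrow> (int^3 \<Rightarrow> 3 \<Rightarrow> complex) \<Rightarrow> 3 \<Rightarrow> complex"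
  where "quad k V j = \<i> * (\<Sum>q\<in>splits k. dot k (V q) * V (k - q) j)"

text \<open>Minus the Leray projection of the convective term.\<close>

definition force :: "int^3 \<Rightarrow> (int^3 \<Rightarrow> 3 \<Rightarrow> complex) \<Rightarrow> 3 \<Rightarrow> complex"
  where "force k V j = of_int (k$j) * dot k (quad k V) / of_real (sqnorm k) - quad k V j"

lemma quad_cong:
  assumes "\<And>q m. size1 q < size1 k \<Longrightarrow> V q m = W q m"
  shows "quad k V j = quad k W j"
  unfolding quad_def dot_def
  by (intro arg_cong2[of _ _ _ _ "(*)"] refl sum.cong) (use splitsD assms in auto)

text \<open>The force at \<open>k\<close> depends only on the coefficients at shorter frequencies; this is what makes the
  recursion for the coefficients terminate.\<close>

lemma force_cong [fundef_cong]:
  assumes "k = k'" "j = j'" "\<And>q m. size1 q < size1 k' \<Longrightarrow> V q m = W q m"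
  shows "force k V j = force k' W j'"
proof -
  have "quad k' V = quad k' W" using quad_cong[OF assms(3)] by (simp add: fun_eq_iff)
  then show ?thesis using assms(1,2) by (simp add: force_def)
qed

lemma norm_quad_le:
  assumes "\<And>q m. q \<in> M \<Longrightarrow> norm (V q m) \<le> v q"
  shows "norm (quad k V j) \<le> real (size1 k) * (\<Sum>q\<in>splits k. v q * v (k - q))"
proof -
  have "norm (quad k V j) \<le> (\<Sum>q\<in>splits k. (real (size1 k) * v q) * v (k - q))"
    unfolding quad_def norm_mult norm_ii mult_1
  proof (rule order_trans[OF norm_sum], rule sum_mono)
    fix q assume q: "q \<in> splits k"
    have v: "norm (V q m) \<le> v q" "norm (V (k - q) m) \<le> v (k - q)" for m
      using assms splitsD(1,2)[OF q] by auto
    have "0 \<le> v q" using v(1)[of undefined] norm_ge_zero order_trans by blast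
    then show "norm (dot k (V q) * V (k - q) j) \<le> (real (size1 k) * v q) * v (k - q)"
      unfolding norm_mult by (intro mult_mono norm_dot_le v) auto
  qed
  then show ?thesis by (simp add: sum_distrib_left mult.assoc)
qed

lemma norm_force_le:
  assumes "k \<in> M" "\<And>q m. q \<in> M \<Longrightarrow> norm (V q m) \<le> v q"
  shows "norm (force k V j) \<le> 3 * real (size1 k) * (\<Sum>q\<in>splits k. v q * v (k - q))"
proof -
  define R where "R = real (size1 k) * (\<Sum>q\<in>splits k. v q * v (k - q))"
  have R: "norm (quad k V l) \<le> R" for l unfolding R_def by (rule norm_quad_le[OF assms(2)])
  then have R0: "R \<ge> 0" using norm_ge_zero order_trans by blast
  have sq: "sqnorm k > 0" using sqnorm_pos[of k] assms(1) zero_notin by fastforce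
  have "norm (of_int (k$j) * dot k (quad k V) / of_real (sqnorm k))
      \<le> \<bar>real_of_int (k$j)\<bar> * (real (size1 k) * R) / sqnorm k"
    using norm_dot_le[OF R, of k] sq
    by (simp add: norm_mult norm_divide divide_right_mono mult_left_mono)
  also have "\<dots> \<le> (2 * sqnorm k) * R / sqnorm k"
    using mult_right_mono[OF component_size1_le[of k j] R0] sq
    by (intro divide_right_mono) (simp_all add: mult.assoc)
  also have "\<dots> = 2 * R" using sq by simp
  finally have "norm (force k V j) \<le> 2 * R + R"
    unfolding force_def by (intro order_trans[OF norm_triangle_ineq4] add_mono R)
  then show ?thesis by (simp add: R_def)
qed

lemma dot_force:
  assumes "k \<in> M"
  shows "dot k (force k V) = 0"
proof -
  have sq: "sqnorm k \<noteq> 0" using sqnorm_pos[of k] assms zero_notin by fastforce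
  have "dot k (force k V)
      = dot k (\<lambda>j. of_int (k$j) * (dot k (quad k V) / of_real (sqnorm k))) - dot k (quad k V)"
    by (simp add: force_def dot_def right_diff_distrib sum_subtractf)
  also have "\<dots> = 0" unfolding dot_self using sq by simp
  finally show ?thesis .
qed

end

section \<open>Recursive construction of the Fourier coefficients\<close>

text \<open>The data of the problem: \<open>mean\<close> is the constant mode of the initial velocity, \<open>B j k\<close> are the
  coefficients of its \<open>j\<close>-th component at the other modes, and \<open>b\<close> bounds them, with small sum and
  finite second moment.\<close>

locale fourier_data = mode_cone +
  fixes \<nu> :: real and mean :: "3 \<Rightarrow> complex" and B :: "3 \<Rightarrow> int^3 \<Rightarrow> complex"
    and b :: "int^3 \<Rightarrow> real"
  assumes nu: "\<nu> \<ge> 1"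
    and div_free: "k \<in> M \<Longrightarrow> dot k (\<lambda>j. B j k) = 0"
    and B_le: "norm (B j k) \<le> b k"
    and sum_b: "finite F \<Longrightarrow> F \<subseteq> M \<Longrightarrow> (\<Sum>k\<in>F. b k) \<le> 1/60"
    and moment_b: "(\<lambda>k. sqnorm k * b k) summable_on M"
begin

lemma b_nonneg: "b k \<ge> 0"
  using B_le norm_ge_zero order_trans by blast

text \<open>The spatial mean of the velocity is prescribed to be \<open>mean j * exp (- rate * t)\<close>, and \<open>drift\<close> is the
  integral of the exponential from 0 to \<open>t\<close>. The rate is chosen such that, after completing the
  square, transport by the mean contributes at most \<open>1/10\<close> to the exponent in
  \<open>norm_symbol_quotient_le\<close>.\<close>

definition mean_bound :: real where "mean_bound = (\<Sum>j\<in>UNIV. norm (mean j))"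
definition rate :: real where "rate = 15 * mean_bound\<^sup>2 + 1"
definition drift :: "real \<Rightarrow> real" where "drift t = (1 - exp (- rate * t)) / rate"
definition mean_flow :: "3 \<Rightarrow> real \<Rightarrow> complex"
  where "mean_flow j t = mean j * of_real (exp (- rate * t))"

text \<open>The fundamental solution of the linear part of the equation for the mode \<open>k\<close>: diffusion and
  transport by the spatial mean.\<close>

definition symbol :: "int^3 \<Rightarrow> real \<Rightarrow> complex"
  where "symbol k t = exp (- of_real (\<nu> * sqnorm k * t) - \<i> * dot k mean * of_real (drift t))"

lemma rate_pos: "rate > 0" by (simp add: rate_def add_nonneg_pos)

lemma symbol_0 [simp]: "symbol k 0 = 1"
  by (simp add: symbol_def drift_def)

lemma symbol_nonzero [simp]: "symbol k t \<noteq> 0"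
  by (simp add: symbol_def)

lemma drift_has_derivative:
  "(drift has_real_derivative exp (- rate * t)) (at t within S)"
  unfolding drift_def using rate_pos by (auto intro!: derivative_eq_intros)

lemma symbol_has_vector_derivative:
  "(symbol k has_vector_derivative
     (- of_real (\<nu> * sqnorm k) - \<i> * dot k (\<lambda>j. mean_flow j t)) * symbol k t) (at t within S)"
proof -
  have d: "((\<lambda>t. complex_of_real (drift t)) has_vector_derivative of_real (exp (- rate * t))) (at t within S)"
    using drift_has_derivative by (rule has_vector_derivative_of_real)
  have l: "((\<lambda>t. complex_of_real (\<nu> * sqnorm k * t)) has_vector_derivative of_real (\<nu> * sqnorm k)) (at t within S)"
    by (intro has_vector_derivative_of_real DERIV_subset[OF DERIV_cmult_Id subset_UNIV])
  have "((\<lambda>t. - of_real (\<nu> * sqnorm k * t) - \<i> * dot k mean * of_real (drift t)) has_vector_derivative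
     (- of_real (\<nu> * sqnorm k) - \<i> * dot k mean * of_real (exp (- rate * t)))) (at t within S)"
    by (intro has_vector_derivative_diff has_vector_derivative_minus l
          has_vector_derivative_mult_right d)
  from field_vector_diff_chain_within[OF this DERIV_subset[OF DERIV_exp subset_UNIV]]
  have "((exp \<circ> (\<lambda>t. - of_real (\<nu> * sqnorm k * t) - \<i> * dot k mean * of_real (drift t))) has_vector_derivative
     (- of_real (\<nu> * sqnorm k) - \<i> * dot k mean * of_real (exp (- rate * t))) * symbol k t) (at t within S)"
    by (simp only: symbol_def)
  moreover have "dot k (\<lambda>j. mean_flow j t) = dot k mean * of_real (exp (- rate * t))"
    by (simp add: mean_flow_def dot_def sum_distrib_right mult.assoc)
  ultimately show ?thesis by (simp add: o_def symbol_def[abs_def] mult.assoc)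
qed

lemma norm_symbol_quotient_le:
  assumes "0 \<le> s" "s \<le> t"
  shows "norm (symbol k t / symbol k s) \<le> 6/5 * exp (- sqnorm k * (t - s) / 2)"
proof -
  define h where "h = drift t - drift s"
  have h_eq: "h = (exp (- rate * s) - exp (- rate * t)) / rate"
    by (simp add: h_def drift_def diff_divide_distrib)
  have h0: "h \<ge> 0" unfolding h_eq using rate_pos assms by (intro divide_nonneg_pos) auto
  have h1: "h \<le> 1 / rate"
  proof (unfold h_eq, rule divide_right_mono)
    have "exp (- rate * s) \<le> 1" "0 < exp (- rate * t)" using rate_pos assms by auto
    then show "exp (- rate * s) - exp (- rate * t) \<le> 1" by linarith
  qed (use rate_pos in simp)
  have h2: "h \<le> t - s"
  proof -
    have "exp (- rate * s) - exp (- rate * t) = exp (- rate * s) * (1 - exp (- rate * (t - s)))"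
      by (simp add: right_diff_distrib mult_exp_exp algebra_simps)
    also have "\<dots> \<le> 1 * (rate * (t - s))"
    proof (intro mult_mono)
      show "1 - exp (- rate * (t - s)) \<le> rate * (t - s)"
        using exp_ge_add_one_self[of "- rate * (t - s)"] by simp
    qed (use rate_pos assms in auto)
    finally show ?thesis unfolding h_eq using rate_pos by (simp add: divide_le_eq mult.commute)
  qed
  have b0: "mean_bound \<ge> 0" by (simp add: mean_bound_def sum_nonneg)
  have "norm (mean l) \<le> mean_bound" for l unfolding mean_bound_def by (rule member_le_sum) auto
  then have "norm (dot k mean) \<le> real (size1 k) * mean_bound" by (rule norm_dot_le)
  then have im: "Im (dot k mean) \<le> real (size1 k) * mean_bound"
    using abs_Im_le_cmod[of "dot k mean"] by linarith
  \<comment> \<open>Completing the square: the quadratic part goes into diffusion, at the cost of a constant.\<close>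
  have "0 \<le> (real (size1 k) - 3 * mean_bound)\<^sup>2" by simp
  then have "6 * (real (size1 k) * mean_bound) \<le> (real (size1 k))\<^sup>2 + 9 * mean_bound\<^sup>2"
    by (simp add: power2_eq_square algebra_simps)
  with im size1_sq_le[of k] have im2: "Im (dot k mean) \<le> sqnorm k / 2 + 3/2 * mean_bound\<^sup>2" by linarith
  have sq: "sqnorm k \<ge> 0" using size1_le_sqnorm[of k] by linarith
  have "Im (dot k mean) * h \<le> (sqnorm k / 2 + 3/2 * mean_bound\<^sup>2) * h"
    using im2 h0 by (rule mult_right_mono)
  also have "\<dots> = sqnorm k / 2 * h + 3/2 * mean_bound\<^sup>2 * h" by (simp add: distrib_right)
  also have "\<dots> \<le> sqnorm k / 2 * (t - s) + 3/2 * mean_bound\<^sup>2 * (1 / rate)"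
    using h1 h2 sq by (intro add_mono mult_left_mono) auto
  also have "3/2 * mean_bound\<^sup>2 * (1 / rate) \<le> 1/10"
    using rate_pos by (simp add: rate_def divide_le_eq)
  finally have *: "Im (dot k mean) * h \<le> sqnorm k / 2 * (t - s) + 1/10" by simp
  have "1 * (sqnorm k * (t - s)) \<le> \<nu> * (sqnorm k * (t - s))"
    using nu sq assms by (intro mult_right_mono) auto
  with * have e: "- (\<nu> * sqnorm k * (t - s)) + Im (dot k mean) * h \<le> 1/10 + (- sqnorm k * (t - s) / 2)"
    by (simp add: mult.assoc)
  have "symbol k t / symbol k s
      = exp (- of_real (\<nu> * sqnorm k * (t - s)) - \<i> * dot k mean * of_real h)"
    unfolding symbol_def exp_diff[symmetric] by (simp add: h_def algebra_simps)
  then have "norm (symbol k t / symbol k s) = exp (- (\<nu> * sqnorm k * (t - s)) + Im (dot k mean) * h)"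
    by simp
  also have "\<dots> \<le> exp (1/10) * exp (- sqnorm k * (t - s) / 2)"
    unfolding mult_exp_exp using e by simp
  also have "\<dots> \<le> 6/5 * exp (- sqnorm k * (t - s) / 2)"
    using exp_bound[of "1/10"] by (intro mult_right_mono) (auto simp: power2_eq_square)
  finally show ?thesis .
qed

text \<open>The coefficients of the velocity, by variation of constants. The frequencies outside \<open>M\<close> carry
  nothing; the constant mode is added separately.\<close>

function amp :: "int^3 \<Rightarrow> 3 \<Rightarrow> real \<Rightarrow> complex" where
  "amp k j t = (if k \<in> M then symbol k t * (B j k +
     integral {0..t} (\<lambda>s. force k (\<lambda>q m. amp q m s) j / symbol k s)) else 0)"
  by pat_completeness auto
termination by (relation "Wellfounded.measure (\<lambda>(k, j, t). size1 k)") auto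

declare amp.simps [simp del]

text \<open>The constant \<open>36/5\<close> is \<open>6/5 \<cdot> 3 \<cdot> 2\<close>: the bound of the semigroup, the bound of the force, and the
  integral \<open>2 / |k|\<^sup>2\<close> of \<open>exp (- |k|\<^sup>2 s / 2)\<close>.\<close>

function majorant :: "int^3 \<Rightarrow> real" where
  "majorant k = (if k \<in> M then 6/5 * b k + 36/5 * (real (size1 k) / sqnorm k) *
     (\<Sum>q\<in>splits k. majorant q * majorant (k - q)) else 0)"
  by pat_completeness auto
termination by (relation "Wellfounded.measure size1") (use splitsD in auto)

declare majorant.simps [simp del]

end

section \<open>Bounds uniform in time\<close>

context mode_cone
begin

lemma continuous_on_force:
  assumes "\<And>q m. size1 q < size1 k \<Longrightarrow> continuous_on S (V q m)"
  shows "continuous_on S (\<lambda>s. force k (\<lambda>q m. V q m s) j)"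
proof -
  have quad: "continuous_on S (\<lambda>s. quad k (\<lambda>q m. V q m s) j)" for j
    unfolding quad_def dot_def
  proof (intro continuous_on_mult continuous_on_const continuous_on_sum)
    fix q assume "q \<in> splits k"
    note q = splitsD(4,5)[OF this]
    show "continuous_on S (V q l)" for l by (rule assms[OF q(1)])
    show "continuous_on S (V (k - q) j)" by (rule assms[OF q(2)])
  qed
  show ?thesis
    unfolding force_def dot_def divide_inverse
    by (intro continuous_on_diff continuous_on_mult continuous_on_const continuous_on_sum quad)
qed

text \<open>The frequencies of length at most \<open>N\<close>.\<close>

definition modes_upto :: "nat \<Rightarrow> (int^3) set"
  where "modes_upto N = {k \<in> M. size1 k \<le> N}"

lemma finite_upto [simp]: "finite (modes_upto N)"
  by (rule finite_subset[OF _ finite_size1_le[of N]]) (auto simp: modes_upto_def)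

text \<open>The summands of a frequency of length at most \<open>N + 1\<close> have length at most \<open>N\<close>. This lets the
  total mass of the majorant be bounded by induction on \<open>N\<close>.\<close>

lemma sum_conv_upto_le:
  fixes f :: "int^3 \<Rightarrow> real"
  assumes "\<And>k. f k \<ge> 0"
  shows "(\<Sum>k\<in>modes_upto (Suc N). \<Sum>q\<in>splits k. f q * f (k - q)) \<le> (\<Sum>k\<in>modes_upto N. f k)\<^sup>2"
proof -
  let ?D = "Sigma (modes_upto (Suc N)) splits"
  let ?h = "\<lambda>(k :: int^3, q). (q, k - q)"
  let ?g = "\<lambda>(q, r). f q * f r"
  have inj: "inj_on ?h ?D"
  proof (rule inj_onI)
    fix p p' assume eq: "?h p = ?h p'"
    then show "p = p'" by (cases p, cases p') simp
  qed
  have "(\<Sum>k\<in>modes_upto (Suc N). \<Sum>q\<in>splits k. f q * f (k - q)) = (\<Sum>(k, q)\<in>?D. f q * f (k - q))"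
    by (rule sum.Sigma) (simp_all add: finite_splits)
  also have "\<dots> = (\<Sum>p\<in>?D. ?g (?h p))" by (simp only: case_prod_unfold fst_conv snd_conv)
  also have "\<dots> = sum ?g (?h ` ?D)"
    by (simp only: sum.reindex[OF inj] o_def)
  also have "\<dots> \<le> sum ?g (modes_upto N \<times> modes_upto N)"
  proof (rule sum_mono2)
    show "?h ` ?D \<subseteq> modes_upto N \<times> modes_upto N"
    proof (rule image_subsetI)
      fix p assume "p \<in> ?D"
      then obtain k q where p: "p = (k, q)" and k: "k \<in> modes_upto (Suc N)" and q: "q \<in> splits k"
        by blast
      have "size1 q \<le> N" "size1 (k - q) \<le> N"
        using splitsD(4,5)[OF q] k by (simp_all add: modes_upto_def)
      then show "?h p \<in> modes_upto N \<times> modes_upto N"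
        using splitsD(1,2)[OF q] by (simp add: p modes_upto_def)
    qed
    show "?g p \<ge> 0" for p using assms by (cases p) simp
  qed simp
  also have "\<dots> = (\<Sum>q\<in>modes_upto N. \<Sum>r\<in>modes_upto N. f q * f r)" by (simp only: sum.cartesian_product)
  also have "\<dots> = (\<Sum>k\<in>modes_upto N. f k)\<^sup>2" by (simp only: power2_eq_square sum_product)
  finally show ?thesis .
qed

end

context fourier_data
begin

lemma sqnorm_pos_mode: "k \<in> M \<Longrightarrow> sqnorm k > 0"
  using sqnorm_pos[of k] zero_notin by fastforce

lemma amp_in:
  assumes "k \<in> M"
  shows "amp k j = (\<lambda>t. symbol k t * (B j k +
     integral {0..t} (\<lambda>s. force k (\<lambda>q m. amp q m s) j / symbol k s)))"
  using assms by (subst amp.simps[abs_def]) (simp add: fun_eq_iff)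

lemma amp_notin: "k \<notin> M \<Longrightarrow> amp k j = (\<lambda>t. 0)"
  by (subst amp.simps[abs_def]) (simp add: fun_eq_iff)

lemma amp_at_0: "k \<in> M \<Longrightarrow> amp k j 0 = B j k"
  by (simp add: amp_in)

lemma continuous_on_symbol: "continuous_on S (symbol k)"
  by (rule continuous_on_vector_derivative[OF symbol_has_vector_derivative])

lemma continuous_on_amp: "continuous_on {0..} (amp k j)"
proof (induction "size1 k" arbitrary: k j rule: less_induct)
  case less
  show ?case
  proof (cases "k \<in> M")
    case True
    let ?F = "\<lambda>s. force k (\<lambda>q m. amp q m s) j / symbol k s"
    have "continuous_on {0..} ?F"
      by (intro continuous_on_divide continuous_on_force continuous_on_symbol less) auto
    then have "continuous_on {0..} (\<lambda>t. integral {0..t} ?F)"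
      by (rule continuous_on_vector_derivative[OF integral_has_vector_derivative_atLeast]) simp
    then show ?thesis
      unfolding amp_in[OF True] by (intro continuous_intros continuous_on_symbol)
  next
    case False
    then show ?thesis by (simp add: amp_notin)
  qed
qed

lemma continuous_on_force_amp:
  "continuous_on {0..} (\<lambda>s. force k (\<lambda>q m. amp q m s) j / symbol k s)"
  by (intro continuous_on_divide continuous_on_force continuous_on_symbol continuous_on_amp) auto

lemma amp_has_vector_derivative:
  assumes "k \<in> M" "t \<ge> 0"
  shows "(amp k j has_vector_derivative
     (- of_real (\<nu> * sqnorm k) - \<i> * dot k (\<lambda>j. mean_flow j t)) * amp k j t
       + force k (\<lambda>q m. amp q m t) j) (at t within {0..})"
proof -
  let ?F = "\<lambda>s. force k (\<lambda>q m. amp q m s) j / symbol k s"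
  have "((\<lambda>t. B j k + integral {0..t} ?F) has_vector_derivative 0 + ?F t) (at t within {0..})"
    by (intro has_vector_derivative_add has_vector_derivative_const
        integral_has_vector_derivative_atLeast continuous_on_force_amp assms)
  from has_vector_derivative_mult[OF symbol_has_vector_derivative this, of k]
  show ?thesis unfolding amp_in[OF assms(1), abs_def]
    by (rule back_subst) (simp add: mult.assoc)
qed

text \<open>The velocity stays divergence free, because the force is.\<close>

lemma dot_amp:
  assumes "k \<in> M" "t \<ge> 0"
  shows "dot k (\<lambda>j. amp k j t) = 0"
proof -
  let ?F = "\<lambda>j s. force k (\<lambda>q m. amp q m s) j / symbol k s"
  have int: "?F j integrable_on {0..t}" for j
    by (intro integrable_continuous_real continuous_on_subset[OF continuous_on_force_amp]) auto
  have "dot k (\<lambda>j. integral {0..t} (?F j)) = integral {0..t} (\<lambda>s. \<Sum>j\<in>UNIV. of_int (k$j) * ?F j s)"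
    unfolding dot_def integral_mult_right[symmetric]
    by (rule integral_sum[symmetric]) (simp, rule integrable_on_mult_right[OF int])
  also have "(\<lambda>s. \<Sum>j\<in>UNIV. of_int (k$j) * ?F j s) = (\<lambda>s. dot k (force k (\<lambda>q m. amp q m s)) / symbol k s)"
    by (simp add: dot_def sum_divide_distrib)
  also have "\<dots> = (\<lambda>s. 0)" by (simp add: dot_force[OF assms(1)])
  finally have I: "dot k (\<lambda>j. integral {0..t} (?F j)) = 0" by simp
  have "dot k (\<lambda>j. amp k j t) = symbol k t * (dot k (\<lambda>j. B j k) + dot k (\<lambda>j. integral {0..t} (?F j)))"
    unfolding amp_in[OF assms(1)] by (simp add: dot_def sum_distrib_left distrib_left sum.distrib mult_ac)
  then show ?thesis using I div_free[OF assms(1)] by simp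
qed

lemma majorant_in:
  "k \<in> M \<Longrightarrow> majorant k = 6/5 * b k + 36/5 * (real (size1 k) / sqnorm k) *
     (\<Sum>q\<in>splits k. majorant q * majorant (k - q))"
  by (subst majorant.simps) simp

lemma majorant_nonneg: "majorant k \<ge> 0"
proof (induction "size1 k" arbitrary: k rule: less_induct)
  case less
  show ?case
  proof (cases "k \<in> M")
    case True
    have "(\<Sum>q\<in>splits k. majorant q * majorant (k - q)) \<ge> 0"
      by (intro sum_nonneg mult_nonneg_nonneg less splitsD)
    then show ?thesis using b_nonneg[of k] sqnorm_pos_mode[OF True] by (simp add: majorant_in[OF True])
  next
    case False
    then show ?thesis by (subst majorant.simps) simp
  qed
qed

lemma norm_amp_le: "t \<ge> 0 \<Longrightarrow> norm (amp k j t) \<le> majorant k"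
proof (induction "size1 k" arbitrary: k j t rule: less_induct)
  case less
  show ?case
  proof (cases "k \<in> M")
    case True
    define R where "R = 3 * real (size1 k) * (\<Sum>q\<in>splits k. majorant q * majorant (k - q))"
    define \<mu> where "\<mu> = sqnorm k / 2"
    have mu: "\<mu> > 0" using sqnorm_pos_mode[OF True] by (simp add: \<mu>_def)
    let ?F = "\<lambda>s. force k (\<lambda>q m. amp q m s) j"
    have F: "norm (?F s) \<le> R" if "s \<ge> 0" for s
    proof -
      \<comment> \<open>The coefficients at frequencies that are not shorter do not matter, so they may be cut off.\<close>
      have "?F s = force k (\<lambda>q m. if size1 q < size1 k then amp q m s else 0) j"
        by (rule force_cong) auto
      also have "norm \<dots> \<le> R"
        unfolding R_def by (rule norm_force_le[OF True]) (use less(1) that majorant_nonneg in auto)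
      finally show ?thesis .
    qed
    have R0: "R \<ge> 0" using F[of 0] norm_ge_zero order_trans by (metis order_refl)
    let ?G = "\<lambda>s. 6/5 * R / \<mu> * exp (- \<mu> * (t - s))"
    have G: "((\<lambda>s. 6/5 * R * exp (- \<mu> * (t - s))) has_integral (?G t - ?G 0)) {0..t}"
    proof (rule fundamental_theorem_of_calculus)
      show "(?G has_vector_derivative 6/5 * R * exp (- \<mu> * (t - s))) (at s within {0..t})" for s
        unfolding has_real_derivative_iff_has_vector_derivative[symmetric]
        using mu by (auto intro!: derivative_eq_intros simp: field_simps)
    qed (use less in auto)
    have "norm (integral {0..t} (\<lambda>s. symbol k t * (?F s / symbol k s)))
        \<le> integral {0..t} (\<lambda>s. 6/5 * R * exp (- \<mu> * (t - s)))"
    proof (rule integral_norm_bound_integral)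
      show "(\<lambda>s. symbol k t * (?F s / symbol k s)) integrable_on {0..t}"
        by (intro integrable_on_mult_right integrable_continuous_real
            continuous_on_subset[OF continuous_on_force_amp]) auto
      show "(\<lambda>s. 6/5 * R * exp (- \<mu> * (t - s))) integrable_on {0..t}"
        using G by (rule has_integral_integrable)
      fix s assume s: "s \<in> {0..t}"
      have "norm (symbol k t * (?F s / symbol k s)) = norm (symbol k t / symbol k s) * norm (?F s)"
        by (simp add: norm_mult norm_divide)
      also have "\<dots> \<le> (6/5 * exp (- \<mu> * (t - s))) * R"
        using norm_symbol_quotient_le[of s t k] s F[of s] R0
        by (intro mult_mono) (auto simp: \<mu>_def)
      finally show "norm (symbol k t * (?F s / symbol k s)) \<le> 6/5 * R * exp (- \<mu> * (t - s))"
        by (simp add: mult_ac)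
    qed
    also have "\<dots> = ?G t - ?G 0" using G by (rule integral_unique)
    also have "\<dots> \<le> 6/5 * R / \<mu>" using mu R0 by simp
    also have "\<dots> = 36/5 * (real (size1 k) / sqnorm k) * (\<Sum>q\<in>splits k. majorant q * majorant (k - q))"
      by (simp add: R_def \<mu>_def)
    finally have I: "norm (symbol k t * integral {0..t} (\<lambda>s. ?F s / symbol k s))
        \<le> 36/5 * (real (size1 k) / sqnorm k) * (\<Sum>q\<in>splits k. majorant q * majorant (k - q))"
      by (simp only: integral_mult_right)
    have "norm (symbol k t) \<le> 6/5 * exp (- \<mu> * t)"
      using norm_symbol_quotient_le[of 0 t k] less by (simp add: \<mu>_def)
    also have "\<dots> \<le> 6/5 * 1" using mu less by (intro mult_left_mono) auto
    finally have "norm (symbol k t * B j k) \<le> 6/5 * b k"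
      unfolding norm_mult using B_le[of j k] by (intro mult_mono) auto
    with I show ?thesis
      unfolding majorant_in[OF True] amp_in[OF True] distrib_left
      by (intro order_trans[OF norm_triangle_ineq] add_mono)
  next
    case False
    then show ?thesis by (simp add: amp_notin majorant_nonneg)
  qed
qed

text \<open>The number \<open>3/100\<close> is a subsolution of the fixed point equation:
  \<open>6/5 \<cdot> 1/60 + 36/5 \<cdot> (3/100)\<^sup>2 \<le> 3/100\<close>.\<close>

lemma sum_majorant_upto: "(\<Sum>k\<in>modes_upto N. majorant k) \<le> 3/100"
proof (induction N)
  case 0
  have "modes_upto 0 = {}" using zero_notin by (auto simp: modes_upto_def)
  then show ?case by simp
next
  case (Suc N)
  let ?c = "\<lambda>k. \<Sum>q\<in>splits k. majorant q * majorant (k - q)"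
  have "(\<Sum>k\<in>modes_upto (Suc N). majorant k) \<le> (\<Sum>k\<in>modes_upto (Suc N). 6/5 * b k + 36/5 * ?c k)"
  proof (rule sum_mono)
    fix k assume "k \<in> modes_upto (Suc N)"
    then have k: "k \<in> M" by (simp add: modes_upto_def)
    have c: "?c k \<ge> 0" by (intro sum_nonneg mult_nonneg_nonneg majorant_nonneg)
    have "real (size1 k) / sqnorm k \<le> 1"
      using size1_le_sqnorm[of k] sqnorm_pos_mode[OF k] by simp
    then show "majorant k \<le> 6/5 * b k + 36/5 * ?c k"
      unfolding majorant_in[OF k] using mult_right_mono[OF _ c, of "real (size1 k) / sqnorm k" 1] by simp
  qed
  also have "\<dots> = 6/5 * (\<Sum>k\<in>modes_upto (Suc N). b k) + 36/5 * (\<Sum>k\<in>modes_upto (Suc N). ?c k)"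
    by (simp add: sum.distrib sum_distrib_left)
  also have "\<dots> \<le> 6/5 * (1/60) + 36/5 * (3/100)\<^sup>2"
  proof (intro add_mono mult_left_mono)
    show "(\<Sum>k\<in>modes_upto (Suc N). b k) \<le> 1/60" by (rule sum_b[OF finite_upto]) (auto simp: modes_upto_def)
    have "(\<Sum>k\<in>modes_upto (Suc N). ?c k) \<le> (\<Sum>k\<in>modes_upto N. majorant k)\<^sup>2"
      by (rule sum_conv_upto_le) (rule majorant_nonneg)
    also have "\<dots> \<le> (3/100)\<^sup>2" using Suc by (intro power_mono sum_nonneg majorant_nonneg)
    finally show "(\<Sum>k\<in>modes_upto (Suc N). ?c k) \<le> (3/100)\<^sup>2" .
  qed auto
  also have "\<dots> \<le> 3/100" by (simp add: power2_eq_square)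
  finally show ?case .
qed

lemma majorant_summable: "majorant summable_on M"
proof (rule nonneg_bdd_above_summable_on)
  show "bdd_above (sum majorant ` {F. F \<subseteq> M \<and> finite F})"
  proof (rule bdd_aboveI2)
    fix F assume F: "F \<in> {F. F \<subseteq> M \<and> finite F}"
    define N where "N = Max (insert 0 (size1 ` F))"
    have "F \<subseteq> modes_upto N"
    proof
      fix k assume k: "k \<in> F"
      have "size1 k \<le> N" unfolding N_def using F k by (intro Max_ge) auto
      then show "k \<in> modes_upto N" using F k by (auto simp: modes_upto_def)
    qed
    then have "sum majorant F \<le> sum majorant (modes_upto N)" by (intro sum_mono2 majorant_nonneg) auto
    then show "sum majorant F \<le> 3/100" using sum_majorant_upto[of N] by linarith
  qed
qed (rule majorant_nonneg)

abbreviation majorant_conv :: "int^3 \<Rightarrow> real"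
  where "majorant_conv k \<equiv> \<Sum>q\<in>splits k. majorant q * majorant (k - q)"

lemma majorant_conv_summable: "majorant_conv summable_on M"
  by (rule has_sum_imp_summable[OF conv_has_sum]) (use majorant_summable majorant_nonneg in auto)

lemma sqnorm_majorant_eq:
  assumes "k \<in> M"
  shows "sqnorm k * majorant k = 6/5 * (sqnorm k * b k) + 36/5 * (real (size1 k) * majorant_conv k)"
  using sqnorm_pos_mode[OF assms] by (simp add: majorant_in[OF assms] field_simps)

text \<open>For the first moment the factor \<open>|k|\<^sub>1 / |k|\<^sup>2\<close> in the recursion absorbs the weight \<open>|k|\<^sub>1\<close>.\<close>

lemma majorant_first_moment: "(\<lambda>k. real (size1 k) * majorant k) summable_on M"
proof (rule summable_on_comparison_test)
  show "(\<lambda>k. 6/5 * (sqnorm k * b k) + 108/5 * majorant_conv k) summable_on M"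
    by (intro summable_on_add summable_on_cmult_right moment_b majorant_conv_summable)
  fix k assume k: "k \<in> M"
  have c: "majorant_conv k \<ge> 0" by (intro sum_nonneg mult_nonneg_nonneg majorant_nonneg)
  have "real (size1 k) * b k \<le> sqnorm k * b k"
    by (intro mult_right_mono size1_le_sqnorm b_nonneg)
  moreover have "real (size1 k) * (real (size1 k) / sqnorm k) * majorant_conv k \<le> 3 * majorant_conv k"
    using size1_sq_le[of k] sqnorm_pos_mode[OF k]
    by (intro mult_right_mono c) (simp add: divide_le_eq power2_eq_square)
  moreover have "real (size1 k) * majorant k = 6/5 * (real (size1 k) * b k)
      + 36/5 * (real (size1 k) * (real (size1 k) / sqnorm k) * majorant_conv k)"
    unfolding majorant_in[OF k] by (simp add: distrib_left mult_ac)
  moreover have "m \<le> 6/5 * x' + 108/5 * z" if "x \<le> x'" "y \<le> 3 * z" "m = 6/5 * x + 36/5 * y"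
    for m x x' y z :: real using that by linarith
  ultimately show "real (size1 k) * majorant k \<le> 6/5 * (sqnorm k * b k) + 108/5 * majorant_conv k"
    by blast
qed (intro mult_nonneg_nonneg of_nat_0_le_iff majorant_nonneg)

text \<open>For the second moment one power of \<open>|k|\<^sub>1\<close> remains; it is distributed over the two factors of the
  convolution, where the first moment is available.\<close>

lemma size1_majorant_conv_summable: "(\<lambda>k. real (size1 k) * majorant_conv k) summable_on M"
proof -
  let ?m = "\<lambda>k. real (size1 k) * majorant k"
  have s: "(\<lambda>k. norm (majorant k)) summable_on M" "(\<lambda>k. norm (?m k)) summable_on M"
    using majorant_summable majorant_first_moment majorant_nonneg by auto
  have "(\<lambda>k. (\<Sum>q\<in>splits k. ?m q * majorant (k - q)) + (\<Sum>q\<in>splits k. majorant q * ?m (k - q))) summable_on M"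
    by (intro summable_on_add has_sum_imp_summable[OF conv_has_sum] s)
  also have "(\<lambda>k. (\<Sum>q\<in>splits k. ?m q * majorant (k - q)) + (\<Sum>q\<in>splits k. majorant q * ?m (k - q)))
      = (\<lambda>k. real (size1 k) * majorant_conv k)"
  proof
    fix k
    show "(\<Sum>q\<in>splits k. ?m q * majorant (k - q)) + (\<Sum>q\<in>splits k. majorant q * ?m (k - q))
        = real (size1 k) * majorant_conv k"
      unfolding sum.distrib[symmetric] sum_distrib_left
      by (rule sum.cong) (simp_all add: splitsD(3) algebra_simps)
  qed
  finally show ?thesis .
qed

lemma majorant_second_moment: "(\<lambda>k. sqnorm k * majorant k) summable_on M"
proof -
  have "(\<lambda>k. 6/5 * (sqnorm k * b k) + 36/5 * (real (size1 k) * majorant_conv k)) summable_on M"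
    by (intro summable_on_add summable_on_cmult_right moment_b size1_majorant_conv_summable)
  then show ?thesis
    by (rule summable_on_cong[THEN iffD1, rotated]) (simp add: sqnorm_majorant_eq)
qed

end

section \<open>The velocity and the pressure\<close>

context fourier_data
begin

text \<open>The Fourier coefficients of the periodic part of the pressure, from the divergence of the momentum
  equation.\<close>

definition pressure_coeff :: "int^3 \<Rightarrow> real \<Rightarrow> complex"
  where "pressure_coeff k t = \<i> * dot k (quad k (\<lambda>q m. amp q m t)) / of_real (sqnorm k)"

definition velocity :: "3 \<Rightarrow> real^3 \<Rightarrow> real \<Rightarrow> complex"
  where "velocity j x t = mean_flow j t + fourier_sum M (\<lambda>k. amp k j t) x"

text \<open>The linear part of the pressure supplies the force that makes the mean decay as prescribed.\<close>

definition pressure :: "real^3 \<Rightarrow> real \<Rightarrow> complex"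
  where "pressure x t = of_real rate * (\<Sum>m\<in>UNIV. mean_flow m t * of_real (x$m))
     + fourier_sum M (\<lambda>k. pressure_coeff k t) x"

lemma momentum_coefficients:
  assumes "k \<in> M"
  shows "force k (\<lambda>q m. amp q m t) j + quad k (\<lambda>q m. amp q m t) j + \<i> * of_int (k$j) * pressure_coeff k t = 0"
  by (simp add: force_def pressure_coeff_def flip: mult.assoc)
     (simp add: mult_ac)

lemma amp_summable:
  assumes "t \<ge> 0"
  shows "(\<lambda>k. norm (amp k j t)) summable_on M"
    "(\<lambda>k. real (size1 k) * norm (amp k j t)) summable_on M"
    "(\<lambda>k. norm (\<i> * of_int (k$m) * amp k j t)) summable_on M"
    "(\<lambda>k. real (size1 k) * norm (\<i> * of_int (k$m) * amp k j t)) summable_on M"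
    "(\<lambda>k. norm (\<i> * of_int (k$m) * (\<i> * of_int (k$m) * amp k j t))) summable_on M"
proof -
  have le: "norm (amp k j t) \<le> majorant k" for k using norm_amp_le[OF assms] .
  show "(\<lambda>k. norm (amp k j t)) summable_on M"
    by (rule summable_on_comparison_test[OF majorant_summable]) (simp_all add: le)
  show 1: "(\<lambda>k. real (size1 k) * norm (amp k j t)) summable_on M"
    by (rule summable_on_comparison_test[OF majorant_first_moment]) (simp_all add: le mult_left_mono)
  have c: "\<bar>real_of_int (k$m)\<bar> * norm (amp k j t) \<le> real (size1 k) * norm (amp k j t)" for k
    by (intro mult_right_mono component_le_size1) simp
  show "(\<lambda>k. norm (\<i> * of_int (k$m) * amp k j t)) summable_on M"
    by (rule summable_on_comparison_test[OF 1]) (simp_all add: norm_mult c)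
  have 3: "(\<lambda>k. 3 * (sqnorm k * majorant k)) summable_on M"
    by (intro summable_on_cmult_right majorant_second_moment)
  have s: "real (size1 k) * (\<bar>real_of_int (k$m)\<bar> * norm (amp k j t)) \<le> 3 * (sqnorm k * majorant k)" for k
  proof -
    have "real (size1 k) * (\<bar>real_of_int (k$m)\<bar> * norm (amp k j t))
        \<le> real (size1 k) * (real (size1 k) * norm (amp k j t))"
      by (intro mult_left_mono c) simp
    also have "\<dots> = (real (size1 k))\<^sup>2 * norm (amp k j t)" by (simp add: power2_eq_square)
    also have "\<dots> \<le> (3 * sqnorm k) * majorant k"
      by (intro mult_mono size1_sq_le le) (use size1_le_sqnorm[of k] in simp_all)
    finally show ?thesis by simp
  qed
  show "(\<lambda>k. real (size1 k) * norm (\<i> * of_int (k$m) * amp k j t)) summable_on M"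
    by (rule summable_on_comparison_test[OF 3]) (simp_all add: norm_mult s)
  have "\<bar>real_of_int (k$m)\<bar> * (\<bar>real_of_int (k$m)\<bar> * norm (amp k j t)) \<le> 3 * (sqnorm k * majorant k)" for k
    by (rule order_trans[OF _ s], intro mult_right_mono component_le_size1) simp
  then show "(\<lambda>k. norm (\<i> * of_int (k$m) * (\<i> * of_int (k$m) * amp k j t))) summable_on M"
    by (intro summable_on_comparison_test[OF 3]) (simp_all add: norm_mult)
qed

lemma norm_quad_amp_le:
  "t \<ge> 0 \<Longrightarrow> norm (quad k (\<lambda>q m. amp q m t) j) \<le> real (size1 k) * majorant_conv k"
  by (rule norm_quad_le) (rule norm_amp_le)

lemma pressure_coeff_summable:
  assumes "t \<ge> 0"
  shows "(\<lambda>k. norm (pressure_coeff k t)) summable_on M"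
    "(\<lambda>k. real (size1 k) * norm (pressure_coeff k t)) summable_on M"
proof -
  have le: "real (size1 k) * norm (pressure_coeff k t) \<le> 3 * (real (size1 k) * majorant_conv k)" if k: "k \<in> M" for k
  proof -
    have sq: "sqnorm k > 0" using sqnorm_pos_mode[OF k] .
    have c: "0 \<le> real (size1 k) * majorant_conv k"
      by (intro mult_nonneg_nonneg sum_nonneg majorant_nonneg) simp
    have "norm (dot k (quad k (\<lambda>q m. amp q m t))) \<le> real (size1 k) * (real (size1 k) * majorant_conv k)"
      by (rule norm_dot_le) (rule norm_quad_amp_le[OF assms])
    then have "real (size1 k) * norm (pressure_coeff k t)
        \<le> real (size1 k) * (real (size1 k) * (real (size1 k) * majorant_conv k) / sqnorm k)"
      using sq by (intro mult_left_mono) (simp_all add: pressure_coeff_def norm_mult norm_divide divide_right_mono)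
    also have "\<dots> = (real (size1 k))\<^sup>2 / sqnorm k * (real (size1 k) * majorant_conv k)"
      by (simp add: power2_eq_square)
    also have "\<dots> \<le> 3 * (real (size1 k) * majorant_conv k)"
      using size1_sq_le[of k] sq by (intro mult_right_mono c) (simp add: divide_le_eq)
    finally show ?thesis .
  qed
  show 1: "(\<lambda>k. real (size1 k) * norm (pressure_coeff k t)) summable_on M"
  proof (rule summable_on_comparison_test)
    show "(\<lambda>k. 3 * (real (size1 k) * majorant_conv k)) summable_on M"
      by (intro summable_on_cmult_right size1_majorant_conv_summable)
  qed (simp_all add: le)
  show "(\<lambda>k. norm (pressure_coeff k t)) summable_on M"
  proof (rule summable_on_comparison_test[OF 1])
    fix k assume "k \<in> M"
    from size1_pos[OF this] have "1 * norm (pressure_coeff k t) \<le> real (size1 k) * norm (pressure_coeff k t)"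
      by (intro mult_right_mono) simp_all
    then show "norm (pressure_coeff k t) \<le> real (size1 k) * norm (pressure_coeff k t)" by simp
  qed simp
qed

lemma velocity_pderiv:
  assumes "t \<ge> 0"
  shows "pdifferentiable m (\<lambda>y. velocity j y t) x"
    "pderiv_at m (\<lambda>y. velocity j y t) = fourier_sum M (\<lambda>k. \<i> * of_int (k$m) * amp k j t)"
    "pdifferentiable m (pderiv_at m (\<lambda>y. velocity j y t)) x"
    "pderiv_at m (pderiv_at m (\<lambda>y. velocity j y t))
       = fourier_sum M (\<lambda>k. \<i> * of_int (k$m) * (\<i> * of_int (k$m) * amp k j t))"
proof -
  have d: "((\<lambda>s. velocity j (x + s *\<^sub>R axis m 1) t) has_vector_derivative
      fourier_sum M (\<lambda>k. \<i> * of_int (k$m) * amp k j t) x) (at 0)" for x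
    unfolding velocity_def
    using has_vector_derivative_add[OF has_vector_derivative_const
        fourier_sum_has_pderiv[OF amp_summable(1,2)[OF assms]]] by simp
  show "pdifferentiable m (\<lambda>y. velocity j y t) x" by (rule pderiv_atI(1)[OF d])
  show 1: "pderiv_at m (\<lambda>y. velocity j y t) = fourier_sum M (\<lambda>k. \<i> * of_int (k$m) * amp k j t)"
    by (rule ext, rule pderiv_atI(2)[OF d])
  show "pdifferentiable m (pderiv_at m (\<lambda>y. velocity j y t)) x"
    unfolding 1 by (rule pderiv_atI(1)[OF fourier_sum_has_pderiv[OF amp_summable(3,4)[OF assms]]])
  show "pderiv_at m (pderiv_at m (\<lambda>y. velocity j y t))
       = fourier_sum M (\<lambda>k. \<i> * of_int (k$m) * (\<i> * of_int (k$m) * amp k j t))"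
    unfolding 1 by (rule ext, rule pderiv_atI(2)[OF fourier_sum_has_pderiv[OF amp_summable(3,4)[OF assms]]])
qed

lemma pressure_pderiv:
  assumes "t \<ge> 0"
  shows "pdifferentiable j (\<lambda>y. pressure y t) x"
    "pderiv_at j (\<lambda>y. pressure y t) x
       = of_real rate * mean_flow j t + fourier_sum M (\<lambda>k. \<i> * of_int (k$j) * pressure_coeff k t) x"
proof -
  have lin: "(\<Sum>m\<in>UNIV. mean_flow m t * of_real ((x + s *\<^sub>R axis j 1)$m))
      = (\<Sum>m\<in>UNIV. mean_flow m t * of_real (x$m)) + of_real s * mean_flow j t" for s
  proof -
    have "(\<Sum>m\<in>UNIV. mean_flow m t * of_real ((x + s *\<^sub>R axis j 1)$m))
      = (\<Sum>m\<in>UNIV. mean_flow m t * of_real (x$m) + (if m = j then of_real s * mean_flow j t else 0))"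
      by (rule sum.cong) (simp_all add: axis_def distrib_left)
    then show ?thesis by (simp add: sum.distrib)
  qed
  have "((\<lambda>s. of_real rate * ((\<Sum>m\<in>UNIV. mean_flow m t * of_real (x$m)) + of_real s * mean_flow j t))
      has_vector_derivative of_real rate * (0 + 1 * mean_flow j t)) (at 0)"
    by (intro has_vector_derivative_mult_right has_vector_derivative_add has_vector_derivative_const
        has_vector_derivative_mult_left has_vector_derivative_of_real[where D = 1, simplified] DERIV_ident)
  from has_vector_derivative_add[OF this fourier_sum_has_pderiv[OF pressure_coeff_summable[OF assms]]]
  have d: "((\<lambda>s. pressure (x + s *\<^sub>R axis j 1) t) has_vector_derivative
      of_real rate * mean_flow j t + fourier_sum M (\<lambda>k. \<i> * of_int (k$j) * pressure_coeff k t) x) (at 0)"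
    unfolding pressure_def lin by simp
  show "pdifferentiable j (\<lambda>y. pressure y t) x" by (rule pderiv_atI(1)[OF d])
  show "pderiv_at j (\<lambda>y. pressure y t) x
       = of_real rate * mean_flow j t + fourier_sum M (\<lambda>k. \<i> * of_int (k$j) * pressure_coeff k t) x"
    by (rule pderiv_atI(2)[OF d])
qed

text \<open>The time derivative of the coefficient \<open>amp k j\<close>.\<close>

definition amp_rate :: "int^3 \<Rightarrow> 3 \<Rightarrow> real \<Rightarrow> complex"
  where "amp_rate k j t = (- of_real (\<nu> * sqnorm k) - \<i> * dot k (\<lambda>j. mean_flow j t)) * amp k j t
       + force k (\<lambda>q m. amp q m t) j"

lemma norm_amp_rate_le:
  assumes "k \<in> M" "t \<ge> 0"
  shows "norm (amp_rate k j t)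
     \<le> (\<nu> + mean_bound) * (sqnorm k * majorant k) + 3 * (real (size1 k) * majorant_conv k)"
proof -
  have "norm (mean_flow l t) \<le> mean_bound" for l
  proof -
    have "norm (mean_flow l t) = norm (mean l) * exp (- rate * t)"
      by (simp add: mean_flow_def norm_mult)
    also have "\<dots> \<le> norm (mean l) * 1"
      using rate_pos assms by (intro mult_left_mono) simp_all
    also have "norm (mean l) \<le> mean_bound" unfolding mean_bound_def by (rule member_le_sum) simp_all
    finally show ?thesis by simp
  qed
  then have "norm (dot k (\<lambda>j. mean_flow j t)) \<le> real (size1 k) * mean_bound" by (rule norm_dot_le)
  also have "\<dots> \<le> sqnorm k * mean_bound"
    by (intro mult_right_mono size1_le_sqnorm) (simp add: mean_bound_def sum_nonneg)
  finally have "norm (- of_real (\<nu> * sqnorm k) - \<i> * dot k (\<lambda>j. mean_flow j t))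
      \<le> \<nu> * sqnorm k + sqnorm k * mean_bound"
    using nu sqnorm_pos_mode[OF assms(1)]
    by (intro order_trans[OF norm_triangle_ineq4] add_mono) (simp_all add: norm_mult)
  then have "norm ((- of_real (\<nu> * sqnorm k) - \<i> * dot k (\<lambda>j. mean_flow j t)) * amp k j t)
      \<le> (\<nu> * sqnorm k + sqnorm k * mean_bound) * majorant k"
    unfolding norm_mult by (intro mult_mono' norm_amp_le assms) simp_all
  moreover have "norm (force k (\<lambda>q m. amp q m t) j) \<le> 3 * real (size1 k) * majorant_conv k"
    by (rule norm_force_le[OF assms(1)]) (rule norm_amp_le[OF assms(2)])
  ultimately have "norm (amp_rate k j t)
      \<le> (\<nu> * sqnorm k + sqnorm k * mean_bound) * majorant k + 3 * real (size1 k) * majorant_conv k"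
    unfolding amp_rate_def by (rule norm_triangle_mono)
  also have "\<dots> = (\<nu> + mean_bound) * (sqnorm k * majorant k) + 3 * (real (size1 k) * majorant_conv k)"
    by (simp only: distrib_left distrib_right mult_ac)
  finally show ?thesis .
qed

lemma amp_rate_bound_summable:
  "(\<lambda>k. (\<nu> + mean_bound) * (sqnorm k * majorant k) + 3 * (real (size1 k) * majorant_conv k)) summable_on M"
  by (intro summable_on_add summable_on_cmult_right majorant_second_moment size1_majorant_conv_summable)

lemma velocity_has_time_derivative:
  assumes "t \<ge> 0"
  shows "(velocity j x has_vector_derivative
     - of_real rate * mean_flow j t + fourier_sum M (\<lambda>k. amp_rate k j t) x) (at t within {0..})"
proof -
  have s: "((\<lambda>s. \<Sum>\<^sub>\<infinity>k\<in>M. amp k j s * phi k x) has_vector_derivative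
      (\<Sum>\<^sub>\<infinity>k\<in>M. amp_rate k j t * phi k x)) (at t within {0..})"
  proof (rule has_vector_derivative_infsum[OF _ _ _ _ amp_rate_bound_summable])
    show "((\<lambda>s. amp k j s * phi k x) has_vector_derivative amp_rate k j s * phi k x) (at s within {0..})"
      if "k \<in> M" "s \<in> {0..}" for k s
      unfolding amp_rate_def using that
      by (intro has_vector_derivative_mult_left amp_has_vector_derivative) simp_all
    show "norm (amp_rate k j s * phi k x)
       \<le> (\<nu> + mean_bound) * (sqnorm k * majorant k) + 3 * (real (size1 k) * majorant_conv k)"
      if "k \<in> M" "s \<in> {0..}" for k s
      using norm_amp_rate_le[of k s j] that by (simp add: norm_mult)
    show "(\<lambda>k. amp k j s * phi k x) summable_on M" if "s \<in> {0..}" for s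
      using that by (intro has_sum_imp_summable[OF fourier_sum_has_sum(1)] amp_summable(1)) simp
  qed (use assms in simp_all)
  have e: "((\<lambda>t. exp (- rate * t)) has_real_derivative - rate * exp (- rate * t)) (at t within {0..})"
    by (auto intro!: derivative_eq_intros)
  have "(mean_flow j has_vector_derivative mean j * of_real (- rate * exp (- rate * t))) (at t within {0..})"
    unfolding mean_flow_def[abs_def]
    by (intro has_vector_derivative_mult_right has_vector_derivative_of_real e)
  from has_vector_derivative_add[OF this s]
  show ?thesis unfolding velocity_def[abs_def] fourier_sum_def
    by (simp add: mean_flow_def mult_ac)
qed

lemma convection_has_sum:
  assumes "t \<ge> 0"
  shows "((\<lambda>k. quad k (\<lambda>q m. amp q m t) j * phi k x) has_sum
     (\<Sum>m\<in>UNIV. fourier_sum M (\<lambda>k. amp k m t) x * fourier_sum M (\<lambda>k. \<i> * of_int (k$m) * amp k j t) x)) M"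
proof -
  have "((\<lambda>k. \<Sum>m\<in>UNIV. \<Sum>q\<in>splits k. (amp q m t * phi q x)
        * (\<i> * of_int ((k - q)$m) * amp (k - q) j t * phi (k - q) x)) has_sum
     (\<Sum>m\<in>UNIV. fourier_sum M (\<lambda>k. amp k m t) x * fourier_sum M (\<lambda>k. \<i> * of_int (k$m) * amp k j t) x)) M"
    unfolding fourier_sum_def
    by (intro has_sum_finite_sum conv_has_sum fourier_sum_has_sum(2) amp_summable assms) simp
  moreover have "(\<Sum>m\<in>UNIV. \<Sum>q\<in>splits k. (amp q m t * phi q x)
        * (\<i> * of_int ((k - q)$m) * amp (k - q) j t * phi (k - q) x))
      = quad k (\<lambda>q m. amp q m t) j * phi k x" for k
  proof -
    have "(\<Sum>m\<in>UNIV. (amp q m t * phi q x) * (\<i> * of_int ((k - q)$m) * amp (k - q) j t * phi (k - q) x))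
      = \<i> * (dot k (\<lambda>m. amp q m t) * amp (k - q) j t) * phi k x" if q: "q \<in> splits k" for q
    proof -
      have p: "phi k x = phi q x * phi (k - q) x" using phi_add_mode[of q "k - q" x] by simp
      have "(\<Sum>m\<in>UNIV. (amp q m t * phi q x) * (\<i> * of_int ((k - q)$m) * amp (k - q) j t * phi (k - q) x))
        = \<i> * (dot (k - q) (\<lambda>m. amp q m t) * amp (k - q) j t) * phi k x"
        unfolding dot_def p by (simp add: sum_distrib_left sum_distrib_right mult_ac)
      also have "dot (k - q) (\<lambda>m. amp q m t) = dot k (\<lambda>m. amp q m t) - dot q (\<lambda>m. amp q m t)"
        by (simp add: dot_def left_diff_distrib sum_subtractf)
      also have "dot q (\<lambda>m. amp q m t) = 0" by (rule dot_amp[OF splitsD(1)[OF q] assms])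
      finally show ?thesis by simp
    qed
    then have "(\<Sum>q\<in>splits k. \<Sum>m\<in>UNIV. (amp q m t * phi q x)
        * (\<i> * of_int ((k - q)$m) * amp (k - q) j t * phi (k - q) x))
      = (\<Sum>q\<in>splits k. \<i> * (dot k (\<lambda>m. amp q m t) * amp (k - q) j t) * phi k x)"
      by (rule sum.cong[OF refl])
    then show ?thesis
      by (subst sum.swap) (simp add: quad_def sum_distrib_left sum_distrib_right)
  qed
  ultimately show ?thesis by simp
qed

lemma momentum_equation:
  assumes t: "t \<ge> 0"
  shows "- of_real rate * mean_flow j t + fourier_sum M (\<lambda>k. amp_rate k j t) x
     + (\<Sum>m\<in>UNIV. velocity m x t * fourier_sum M (\<lambda>k. \<i> * of_int (k$m) * amp k j t) x
         - of_real \<nu> * fourier_sum M (\<lambda>k. \<i> * of_int (k$m) * (\<i> * of_int (k$m) * amp k j t)) x)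
     + (of_real rate * mean_flow j t + fourier_sum M (\<lambda>k. \<i> * of_int (k$j) * pressure_coeff k t) x) = 0"
proof -
  let ?q = "\<lambda>k. quad k (\<lambda>q m. amp q m t) j"
  let ?D = "\<lambda>m k. \<i> * of_int (k$m) * amp k j t"
  let ?L = "\<lambda>m k. \<i> * of_int (k$m) * (\<i> * of_int (k$m) * amp k j t)"
  have rate: "(\<lambda>k. norm (amp_rate k j t)) summable_on M"
    by (rule summable_on_comparison_test[OF amp_rate_bound_summable])
       (simp_all add: norm_amp_rate_le[OF _ t])
  have press: "(\<lambda>k. norm (\<i> * of_int (k$j) * pressure_coeff k t)) summable_on M"
    by (rule summable_on_comparison_test[OF pressure_coeff_summable(2)[OF t]])
       (simp_all add: norm_mult mult_right_mono component_le_size1)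
  have "((\<lambda>k. amp_rate k j t * phi k x + (\<Sum>m\<in>UNIV. mean_flow m t * (?D m k * phi k x)) + ?q k * phi k x
        - of_real \<nu> * (\<Sum>m\<in>UNIV. ?L m k * phi k x) + \<i> * of_int (k$j) * pressure_coeff k t * phi k x) has_sum
      (fourier_sum M (\<lambda>k. amp_rate k j t) x + (\<Sum>m\<in>UNIV. mean_flow m t * fourier_sum M (?D m) x)
        + (\<Sum>m\<in>UNIV. fourier_sum M (\<lambda>k. amp k m t) x * fourier_sum M (?D m) x)
        - of_real \<nu> * (\<Sum>m\<in>UNIV. fourier_sum M (?L m) x)
        + fourier_sum M (\<lambda>k. \<i> * of_int (k$j) * pressure_coeff k t) x)) M"
    by (intro has_sum_add has_sum_diff has_sum_finite_sum[OF finite_class.finite_UNIV] has_sum_cmult_right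
        fourier_sum_has_sum(1) convection_has_sum rate press amp_summable t)
  moreover have "amp_rate k j t * phi k x + (\<Sum>m\<in>UNIV. mean_flow m t * (?D m k * phi k x)) + ?q k * phi k x
        - of_real \<nu> * (\<Sum>m\<in>UNIV. ?L m k * phi k x) + \<i> * of_int (k$j) * pressure_coeff k t * phi k x = 0"
    if k: "k \<in> M" for k
  proof -
    have 1: "(\<Sum>m\<in>UNIV. mean_flow m t * (?D m k * phi k x))
        = \<i> * dot k (\<lambda>m. mean_flow m t) * amp k j t * phi k x"
      by (simp add: dot_def sum_distrib_left sum_distrib_right mult_ac)
    have ii: "\<i> * (\<i> * z) = - z" for z :: complex by (simp flip: mult.assoc)
    have 2: "(\<Sum>m\<in>UNIV. ?L m k * phi k x) = - (of_real (sqnorm k) * amp k j t * phi k x)"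
    proof -
      have "?L m k * phi k x = - ((of_int (k$m))\<^sup>2 * (amp k j t * phi k x))" for m
      proof -
        have "?L m k * phi k x = \<i> * (\<i> * ((of_int (k$m))\<^sup>2 * (amp k j t * phi k x)))"
          by (simp only: power2_eq_square mult_ac)
        then show ?thesis unfolding ii .
      qed
      then show ?thesis
        by (simp add: sqnorm_def sum_distrib_right sum_negf mult.assoc)
    qed
    have 3: "force k (\<lambda>q m. amp q m t) j + ?q k + \<i> * of_int (k$j) * pressure_coeff k t = 0"
      by (rule momentum_coefficients[OF k])
    have "amp_rate k j t * phi k x + (\<Sum>m\<in>UNIV. mean_flow m t * (?D m k * phi k x)) + ?q k * phi k x
        - of_real \<nu> * (\<Sum>m\<in>UNIV. ?L m k * phi k x) + \<i> * of_int (k$j) * pressure_coeff k t * phi k x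
      = (force k (\<lambda>q m. amp q m t) j + ?q k + \<i> * of_int (k$j) * pressure_coeff k t) * phi k x"
      unfolding 1 2 amp_rate_def by (simp add: algebra_simps)
    then show ?thesis unfolding 3 by simp
  qed
  ultimately have "((\<lambda>k. 0) has_sum
      (fourier_sum M (\<lambda>k. amp_rate k j t) x + (\<Sum>m\<in>UNIV. mean_flow m t * fourier_sum M (?D m) x)
        + (\<Sum>m\<in>UNIV. fourier_sum M (\<lambda>k. amp k m t) x * fourier_sum M (?D m) x)
        - of_real \<nu> * (\<Sum>m\<in>UNIV. fourier_sum M (?L m) x)
        + fourier_sum M (\<lambda>k. \<i> * of_int (k$j) * pressure_coeff k t) x)) M"
    by (rule has_sum_cong[THEN iffD1, rotated])
  from has_sum_unique[OF this has_sum_0[OF refl]]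
  show ?thesis
    by (simp add: velocity_def distrib_right sum.distrib sum_subtractf sum_distrib_left algebra_simps)
qed

lemma divergence_equation:
  assumes t: "t \<ge> 0"
  shows "(\<Sum>m\<in>UNIV. fourier_sum M (\<lambda>k. \<i> * of_int (k$m) * amp k m t) x) = 0"
proof -
  have "((\<lambda>k. \<Sum>m\<in>UNIV. \<i> * of_int (k$m) * amp k m t * phi k x) has_sum
      (\<Sum>m\<in>UNIV. fourier_sum M (\<lambda>k. \<i> * of_int (k$m) * amp k m t) x)) M"
    by (intro has_sum_finite_sum[OF finite_class.finite_UNIV] fourier_sum_has_sum(1) amp_summable t)
  moreover have "(\<Sum>m\<in>UNIV. \<i> * of_int (k$m) * amp k m t * phi k x) = 0" if "k \<in> M" for k
  proof -
    have "(\<Sum>m\<in>UNIV. \<i> * of_int (k$m) * amp k m t * phi k x)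
        = \<i> * dot k (\<lambda>m. amp k m t) * phi k x"
      by (simp add: dot_def sum_distrib_left sum_distrib_right mult_ac)
    then show ?thesis using dot_amp[OF that t] by simp
  qed
  ultimately have "((\<lambda>k. 0) has_sum
      (\<Sum>m\<in>UNIV. fourier_sum M (\<lambda>k. \<i> * of_int (k$m) * amp k m t) x)) M"
    by (rule has_sum_cong[THEN iffD1, rotated])
  from has_sum_unique[OF this has_sum_0[OF refl]] show ?thesis .
qed

theorem navier_stokes_velocity_pressure: "navier_stokes_solution \<nu> velocity pressure"
  unfolding navier_stokes_solution_def
proof (intro allI impI conjI)
  fix x t j m assume t: "t \<ge> (0::real)"
  have d: "(velocity j x has_vector_derivative
     - of_real rate * mean_flow j t + fourier_sum M (\<lambda>k. amp_rate k j t) x) (at t within {0..})" for j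
    by (rule velocity_has_time_derivative[OF t])
  show "velocity j x differentiable (at t within {0..})"
    using d by (rule differentiableI_vector)
  show "pdifferentiable m (\<lambda>y. velocity j y t) x"
    "pdifferentiable m (pderiv_at m (\<lambda>y. velocity j y t)) x"
    by (rule velocity_pderiv[OF t])+
  show "pdifferentiable j (\<lambda>y. pressure y t) x" by (rule pressure_pderiv[OF t])
  have v: "vector_derivative (velocity j x) (at t within {0..})
      = - of_real rate * mean_flow j t + fourier_sum M (\<lambda>k. amp_rate k j t) x"
  proof (rule vector_derivative_within[OF _ d])
    have "t islimpt {0..t + 1}" using t by simp
    then have "t islimpt {0..}" by (rule islimpt_subset) auto
    then show "at t within {0..} \<noteq> bot" by (simp add: trivial_limit_within)
  qed
  show "vector_derivative (velocity j x) (at t within {0..})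
            + (\<Sum>m\<in>UNIV. velocity m x t * pderiv_at m (\<lambda>y. velocity j y t) x
                 - of_real \<nu> * pderiv_at m (pderiv_at m (\<lambda>y. velocity j y t)) x)
            + pderiv_at j (\<lambda>y. pressure y t) x = 0"
    unfolding v velocity_pderiv(4)[OF t] pressure_pderiv(2)[OF t] unfolding velocity_pderiv(2)[OF t] by (rule momentum_equation[OF t])
  show "(\<Sum>m\<in>UNIV. pderiv_at m (\<lambda>y. velocity m y t) x) = 0"
    unfolding velocity_pderiv(2)[OF t] by (rule divergence_equation[OF t])
qed

lemma velocity_at_0: "velocity j x 0 = mean j + (\<Sum>\<^sub>\<infinity>k\<in>M. B j k * phi k x)"
  unfolding velocity_def fourier_sum_def mean_flow_def
  by (simp add: amp_at_0 cong: infsum_cong)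

end

section \<open>Existence of a classical solution\<close>

theorem theorem2p6:
  fixes \<nu> :: real and a b c :: int and B :: "3 \<Rightarrow> int^3 \<Rightarrow> complex"
  assumes "\<nu> \<ge> 1"
    and "a \<in> {1, -1}" and "b \<in> {1, -1}" and "c \<in> {1, -1}"
    and "\<And>j x. (\<lambda>k. B j k * phi k x) summable_on octant a b c"
    and "\<And>j. (\<lambda>x. \<Sum>\<^sub>\<infinity>k\<in>octant a b c. B j k * phi k x) \<in> IE"
    and "\<And>k. k \<in> octant a b c \<Longrightarrow>
           of_int (k$1) * B 1 k + of_int (k$2) * B 2 k + of_int (k$3) * B 3 k = 0"
    and "\<And>j k. k \<in> octant a b c \<Longrightarrow> (a * k$1, b * k$2, c * k$3) \<noteq> (0, 0, 0) \<Longrightarrow>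
           norm (B j k) \<le> exp (- (\<Sum>l\<in>UNIV. real_of_int \<bar>k$l\<bar>)) / 10 ^ 3 *
             (\<Prod>l\<in>{l. \<bar>k$l\<bar> > 0}.
                real_of_int \<bar>k$l\<bar> ^ (nat \<bar>k$l\<bar> - 1) / fact (nat \<bar>k$l\<bar>))"
  shows "\<exists>(u :: 3 \<Rightarrow> real^3 \<Rightarrow> real \<Rightarrow> complex) (p :: real^3 \<Rightarrow> real \<Rightarrow> complex).
           navier_stokes_solution \<nu> u p \<and>
           (\<forall>j x. u j x 0 = (\<Sum>\<^sub>\<infinity>k\<in>octant a b c. B j k * phi k x))"
proof -
  define M where "M = octant a b c - {0}"
  \<comment> \<open>The maximum, rather than the sum, over the three components keeps the smallness constant.\<close>
  define bound where "bound k = Max (range (\<lambda>j. norm (B j k)))" for k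
  have bound_ge: "norm (B j k) \<le> bound k" for j k
    unfolding bound_def by (rule Max_ge) simp_all
  have bound_nonneg: "bound k \<ge> 0" for k
    using bound_ge norm_ge_zero order_trans by blast
  have bound_le: "bound k \<le> (\<Prod>l\<in>UNIV. tree_weight (nat \<bar>k$l\<bar>)) / 1000" if "k \<in> M" for k
  proof -
    have k: "k \<in> octant a b c" "k \<noteq> 0" using that by (simp_all add: M_def)
    have "(a * k$1, b * k$2, c * k$3) \<noteq> (0, 0, 0)"
      using k(2) assms(2,3,4) by (auto simp: vec_eq_iff forall_3)
    from assms(8)[OF k(1) this]
    have "norm (B j k) \<le> (\<Prod>l\<in>UNIV. tree_weight (nat \<bar>k$l\<bar>)) / 1000" for j
      unfolding tree_weight_prod_eq[symmetric] by simp
    then show ?thesis unfolding bound_def by (subst Max_le_iff) auto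
  qed
  have oct0: "0 \<in> octant a b c" by (simp add: octant_def)
  interpret mode_cone M unfolding M_def by (rule mode_cone_octant[OF assms(2-4)])
  interpret fourier_data M \<nu> "\<lambda>j. B j 0" B bound
  proof
    show "dot k (\<lambda>j. B j k) = 0" if "k \<in> M" for k
      using assms(7)[of k] that by (simp add: M_def dot_def sum_3)
    show "(\<Sum>k\<in>F. bound k) \<le> 1/60" if F: "finite F" "F \<subseteq> M" for F
    proof -
      have "(\<Sum>k\<in>F. bound k) \<le> (\<Sum>k\<in>F. (\<Prod>l\<in>UNIV. tree_weight (nat \<bar>k$l\<bar>)) / 1000)"
        using F by (intro sum_mono bound_le) blast
      also have "\<dots> = (\<Sum>k\<in>F. \<Prod>l\<in>UNIV. tree_weight (nat \<bar>k$l\<bar>)) / 1000"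
        by (rule sum_divide_distrib[symmetric])
      also have "\<dots> \<le> 16 / 1000"
        using F by (intro divide_right_mono sum_tree_weights_octant[OF assms(2-4)]) (auto simp: M_def)
      finally show ?thesis by simp
    qed
    have "(\<lambda>k. sqnorm k * norm (B j k)) summable_on M" for j
      by (rule summable_on_subset_banach[OF IE_second_moment[OF assms(5,6)]]) (auto simp: M_def)
    then have s: "(\<lambda>k. sqnorm k * norm (B 1 k) + sqnorm k * norm (B 2 k) + sqnorm k * norm (B 3 k)) summable_on M"
      by (intro summable_on_add)
    have sq: "sqnorm k \<ge> 0" for k using size1_le_sqnorm[of k] by linarith
    show "(\<lambda>k. sqnorm k * bound k) summable_on M"
    proof (rule summable_on_comparison_test[OF s])
      fix k
      have "bound k \<in> range (\<lambda>j. norm (B j k))" unfolding bound_def by (rule Max_in) simp_all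
      then obtain j where "bound k = norm (B j k)" by blast
      then have "bound k \<le> norm (B 1 k) + norm (B 2 k) + norm (B 3 k)"
        using exhaust_3[of j] by auto
      from mult_left_mono[OF this sq[of k]]
      show "sqnorm k * bound k \<le> sqnorm k * norm (B 1 k) + sqnorm k * norm (B 2 k) + sqnorm k * norm (B 3 k)"
        by (simp add: distrib_left)
    qed (intro mult_nonneg_nonneg sq bound_nonneg)
  qed (use assms(1) bound_ge in auto)
  have "velocity j x 0 = (\<Sum>\<^sub>\<infinity>k\<in>octant a b c. B j k * phi k x)" for j x
  proof -
    have "(\<lambda>k. B j k * phi k x) summable_on M"
      by (rule summable_on_subset_banach[OF assms(5)]) (auto simp: M_def)
    then have "(\<Sum>\<^sub>\<infinity>k\<in>insert 0 M. B j k * phi k x) = B j 0 * phi 0 x + (\<Sum>\<^sub>\<infinity>k\<in>M. B j k * phi k x)"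
      using zero_notin by (intro infsum_insert)
    also have "insert 0 M = octant a b c" using oct0 by (auto simp: M_def)
    finally show ?thesis by (simp add: velocity_at_0)
  qed
  then show ?thesis using navier_stokes_velocity_pressure by blast
qed

end
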